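(* Let $r \geqslant 2$ be an integer and set $C := 2^8 r^2$. Let $N = N(n) \geqslant rn - n/3$ and let $p = p(n)$ satisfy $p \gg n^{-2/(r+2)}$. Then, with high probability as $n \to \infty$, $G = G(N,p)$ has the following property: for every red-blue colouring of the edges of $G$, at least one of the following holds: (a) $G$ contains a blue copy of $K_{r+1}$; (b) $G$ contains a red copy of $P_n$; (c) there exists a partition $V(G) = A_0 \cup A_1 \cup \cdots \cup A_r$ with $|A_0| \leqslant C/p$ and $|A_i| \leqslant n$ for each $i \in \{1,\ldots,r\}$, such that for each $1 \leqslant i < j \leqslant r$, every edge of $G$ between $A_i$ and $A_j$ is blue.
   Context: $G(N,p)$ denotes the Erdős–Rényi random graph on $N$ vertices in which each pair is an edge independently with probability $p$. $P_n$ is the path with $n$ edges, and $K_{r+1}$ is the complete graph on $r+1$ vertices. For functions $f,g$, $f \gg g$ means $f/g \to \infty$ as $n \to \infty$. "With high probability" means with probability tending to $1$ as $n \to \infty$. *)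

theory Defs
  imports "HOL-Probability.Probability"
begin

text \<open>A simple graph is a pair (vertex set, edge set); edges are two-element sets of vertices.\<close>

type_synonym 'a graph = "'a set \<times> 'a set set"

abbreviation verts :: "'a graph \<Rightarrow> 'a set" where "verts \<equiv> fst"
abbreviation edges :: "'a graph \<Rightarrow> 'a set set" where "edges \<equiv> snd"

definition pairs :: "'a set \<Rightarrow> 'a set set" where
  "pairs V = {e. e \<subseteq> V \<and> card e = 2}"

definition complete_simple_graph :: "nat \<Rightarrow> nat graph" where
  "complete_simple_graph m = ({..<m}, pairs {..<m})"

text \<open>The parameter of a path counts edges, so there are \<open>n + 1\<close> vertices.\<close>

definition path_graph :: "nat \<Rightarrow> nat graph" where
  "path_graph n = ({..n}, {{i, Suc i} | i. i < n})"

text \<open>Copies are subgraphs, not necessarily induced.\<close>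

definition contains_copy :: "'a graph \<Rightarrow> 'b graph \<Rightarrow> bool" where
  "contains_copy G H \<longleftrightarrow>
     (\<exists>f. inj_on f (verts H) \<and> f ` verts H \<subseteq> verts G \<and> (\<forall>e\<in>edges H. f ` e \<in> edges G))"

datatype colour = Red | Blue

definition colour_subgraph :: "'a graph \<Rightarrow> ('a set \<Rightarrow> colour) \<Rightarrow> colour \<Rightarrow> 'a graph" where
  "colour_subgraph G c k = (verts G, {e \<in> edges G. c e = k})"

text \<open>Parts of the partition may be empty.\<close>

definition indexed_partition :: "'a set \<Rightarrow> nat \<Rightarrow> (nat \<Rightarrow> 'a set) \<Rightarrow> bool" where
  "indexed_partition V r A \<longleftrightarrow> (\<Union>i\<in>{0..r}. A i) = V \<and> disjoint_family_on A {0..r}"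

definition erdos_renyi :: "nat \<Rightarrow> real \<Rightarrow> nat graph pmf" where
  "erdos_renyi N p =
     map_pmf (\<lambda>b. ({..<N}, {e \<in> pairs {..<N}. b e}))
       (Pi_pmf (pairs {..<N}) False (\<lambda>_. bernoulli_pmf p))"

end

theory Submission
  imports Defs "HOL-Real_Asymp.Real_Asymp"
begin

text \<open>Put \<open>m\<close> about \<open>C / (2 p)\<close> and \<open>a\<close> about \<open>n / (12 r)\<close>.  With high probability, among the first
  \<open>(r + 1) n\<close> vertices any disjoint sets \<open>M, B\<^sub>1, \<dots>, B\<^sub>r\<close> with \<open>|M| \<ge> m\<close> and \<open>|B\<^sub>j| \<ge> a\<close> contain a
  transversal \<open>K\<^bsub>r + 1\<^esub>\<close>.  First, a union bound over single sets \<open>B\<^sub>j\<close> shows that most vertices of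
  \<open>M\<close> have almost the expected degree into every \<open>B\<^sub>j\<close>; hence one can pick \<open>1 / p\<close> vertices of \<open>M\<close>
  with pairwise disjoint neighbourhoods in the \<open>B\<^sub>j\<close>.  Janson's inequality, applied only to the edges
  between the \<open>B\<^sub>j\<close>, then finds a transversal \<open>K\<^sub>r\<close> inside one of these neighbourhoods.  Treating
  the degrees separately keeps \<open>m\<close> of order \<open>r\<^sup>2 / p\<close>; applying Janson's inequality to all edges at once
  would lose a factor \<open>log r\<close>.

  Now suppose that there are neither a blue \<open>K\<^bsub>r + 1\<^esub>\<close> nor a red \<open>P\<^sub>n\<close>.  Then there are no such
  sets \<open>M, B\<^sub>1, \<dots>, B\<^sub>r\<close> without red edges between them.  Delete a largest set \<open>X\<close> of at most \<open>2 m\<close>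
  vertices that does not expand in red; it has fewer than \<open>m\<close> vertices.  In each red component \<open>C\<close> of
  the rest take a longest red path \<open>P\<^sub>C\<close>.  By Posa's rotations, many vertices are ends of such paths
  and have no red neighbours outside \<open>P\<^sub>C\<close>, so there are at most \<open>r\<close> components.  If there are
  \<open>r\<close>, then all but \<open>m\<close> vertices lie on the paths, and the paths are the parts of the partition.  If
  there are fewer, depth-first search outside the paths finds either a path that makes some \<open>P\<^sub>C\<close>
  longer or the missing sets \<open>B\<^sub>j\<close>.\<close>

section \<open>Harris' and Janson's inequalities\<close>

text \<open>This is the expectation of \<open>f\<close> over the subset of \<open>E\<close> that
  contains each element independently with probability \<open>p\<close>. As a finite sum it admits
  induction on \<open>E\<close> and termwise differentiation, and its algebraic rules hold for every
  real \<open>p\<close>.\<close>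

definition bexp :: "real \<Rightarrow> 'a set \<Rightarrow> ('a set \<Rightarrow> real) \<Rightarrow> real" where
  "bexp p E f = (\<Sum>S\<in>Pow E. p ^ card S * (1 - p) ^ card (E - S) * f S)"

lemma bexp_empty [simp]: "bexp p {} f = f {}"
  by (simp add: bexp_def)

text \<open>Conditioning on whether \<open>x\<close> is chosen; this recursion drives the inductions
  on \<open>E\<close> below.\<close>

lemma bexp_insert:
  assumes "finite E" "x \<notin> E"
  shows "bexp p (insert x E) f = p * bexp p E (\<lambda>S. f (insert x S)) + (1 - p) * bexp p E f"
proof -
  have inj: "inj_on (insert x) (Pow E)"
    using assms(2) by (auto simp: inj_on_def)
  have disj: "Pow E \<inter> insert x ` Pow E = {}"
    using assms(2) by auto
  have 1: "(\<Sum>S\<in>Pow E. p ^ card S * (1 - p) ^ card (insert x E - S) * f S) = (1 - p) * bexp p E f"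
    unfolding bexp_def sum_distrib_left
  proof (rule sum.cong)
    fix S assume S: "S \<in> Pow E"
    then have "insert x E - S = insert x (E - S)" using assms by auto
    then have "card (insert x E - S) = Suc (card (E - S))"
      using assms by simp
    then show "p ^ card S * (1 - p) ^ card (insert x E - S) * f S
      = (1 - p) * (p ^ card S * (1 - p) ^ card (E - S) * f S)" by simp
  qed simp
  have 2: "(\<Sum>S\<in>insert x ` Pow E. p ^ card S * (1 - p) ^ card (insert x E - S) * f S)
     = p * bexp p E (\<lambda>S. f (insert x S))"
    unfolding bexp_def sum_distrib_left sum.reindex[OF inj] o_def
  proof (rule sum.cong)
    fix S assume S: "S \<in> Pow E"
    then have "insert x E - insert x S = E - S" using assms by auto
    moreover have "card (insert x S) = Suc (card S)"
      using S assms finite_subset by (subst card_insert_disjoint) auto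
    ultimately show "p ^ card (insert x S) * (1 - p) ^ card (insert x E - insert x S) * f (insert x S)
      = p * (p ^ card S * (1 - p) ^ card (E - S) * f (insert x S))" by simp
  qed simp
  show ?thesis
    unfolding bexp_def[of p "insert x E"] Pow_insert
    using assms disj 1 2 by (subst sum.union_disjoint) auto
qed

lemma bexp_cong:
  assumes "\<And>S. S \<subseteq> E \<Longrightarrow> f S = g S"
  shows "bexp p E f = bexp p E g"
  unfolding bexp_def using assms by (intro sum.cong) auto

lemma bexp_mono:
  assumes "0 \<le> p" "p \<le> 1" "\<And>S. S \<subseteq> E \<Longrightarrow> f S \<le> g S"
  shows "bexp p E f \<le> bexp p E g"
  unfolding bexp_def using assms by (intro sum_mono mult_left_mono) auto

lemma bexp_add: "bexp p E (\<lambda>S. f S + g S) = bexp p E f + bexp p E g"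
  by (simp add: bexp_def distrib_left sum.distrib)

lemma bexp_cmult: "bexp p E (\<lambda>S. c * f S) = c * bexp p E f"
  by (simp add: bexp_def sum_distrib_left mult_ac)

lemma bexp_diff: "bexp p E (\<lambda>S. f S - g S) = bexp p E f - bexp p E g"
  by (simp add: bexp_def right_diff_distrib sum_subtractf)

lemma bexp_sum: "bexp p E (\<lambda>S. \<Sum>i\<in>I. f i S) = (\<Sum>i\<in>I. bexp p E (f i))"
  unfolding bexp_def sum_distrib_left by (rule sum.swap)

lemma bexp_const [simp]: "finite E \<Longrightarrow> bexp p E (\<lambda>_. c) = c"
  by (induction E rule: finite_induct) (auto simp: bexp_insert algebra_simps)

lemma bexp_nonneg:
  assumes "0 \<le> p" "p \<le> 1" "\<And>S. S \<subseteq> E \<Longrightarrow> 0 \<le> f S"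
  shows "0 \<le> bexp p E f"
  unfolding bexp_def using assms by (intro sum_nonneg mult_nonneg_nonneg) auto

text \<open>Fubini's theorem: the traces of the random set on disjoint sets are independent. It
  allows edges to be exposed in two rounds.\<close>

lemma bexp_Un:
  assumes "finite A" "finite B" "A \<inter> B = {}"
  shows "bexp p (A \<union> B) f = bexp p A (\<lambda>S. bexp p B (\<lambda>T. f (S \<union> T)))"
  using assms(1,3)
proof (induction A arbitrary: f rule: finite_induct)
  case (insert x A)
  then have *: "finite (A \<union> B)" "x \<notin> A \<union> B" using assms(2) by auto
  show ?case using insert.IH insert.prems insert.hyps
    by (simp add: bexp_insert[OF *] bexp_insert[OF insert.hyps(1,2)])
qed auto

lemma bexp_full:
  assumes "finite A"
  shows "bexp p A (\<lambda>S. of_bool (A \<subseteq> S) * h S) = p ^ card A * h A"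
proof -
  have "bexp p A (\<lambda>S. of_bool (A \<subseteq> S) * h S)
    = (\<Sum>S\<in>Pow A. if S = A then p ^ card A * h A else 0)"
    unfolding bexp_def by (intro sum.cong) auto
  then show ?thesis using assms by simp
qed

text \<open>Given that \<open>A\<close> is contained in the random set, the rest is still an
  unconditioned random subset of \<open>E - A\<close>.\<close>

lemma bexp_superset:
  assumes "finite E" "A \<subseteq> E"
  shows "bexp p E (\<lambda>S. of_bool (A \<subseteq> S) * f S) = p ^ card A * bexp p (E - A) (\<lambda>T. f (A \<union> T))"
proof -
  have fin: "finite A" "finite (E - A)" using assms finite_subset by auto
  have "bexp p E (\<lambda>S. of_bool (A \<subseteq> S) * f S) = bexp p (A \<union> (E - A)) (\<lambda>S. of_bool (A \<subseteq> S) * f S)"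
    using assms by (simp add: Un_absorb1)
  also have "\<dots> = bexp p A (\<lambda>S. bexp p (E - A) (\<lambda>T. of_bool (A \<subseteq> S \<union> T) * f (S \<union> T)))"
    by (subst bexp_Un) (use fin in auto)
  also have "\<dots> = bexp p A (\<lambda>S. of_bool (A \<subseteq> S) * bexp p (E - A) (\<lambda>T. f (S \<union> T)))"
    unfolding bexp_cmult[symmetric]
    by (intro bexp_cong arg_cong2[where f="(*)"] refl arg_cong[where f=of_bool]) auto
  also have "\<dots> = p ^ card A * bexp p (E - A) (\<lambda>T. f (A \<union> T))"
    by (rule bexp_full) (rule fin)
  finally show ?thesis .
qed

lemma bexp_restrict:
  assumes "finite E" "B \<subseteq> E"
  shows "bexp p E (\<lambda>S. f (S \<inter> B)) = bexp p B f"
proof -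
  have fin: "finite B" "finite (E - B)" using assms finite_subset by auto
  have "bexp p E (\<lambda>S. f (S \<inter> B)) = bexp p (B \<union> (E - B)) (\<lambda>S. f (S \<inter> B))"
    using assms by (simp add: Un_absorb1)
  also have "\<dots> = bexp p B (\<lambda>S. bexp p (E - B) (\<lambda>T. f ((S \<union> T) \<inter> B)))"
    by (subst bexp_Un) (use fin in auto)
  also have "\<dots> = bexp p B (\<lambda>S. bexp p (E - B) (\<lambda>T. f S))"
    by (intro bexp_cong arg_cong[where f=f]) auto
  finally show ?thesis using fin by simp
qed

section \<open>Correlation inequalities\<close>

text \<open>When one element is added, the induction hypothesis handles both conditional
  expectations. What remains is \<open>p * (1 - p)\<close> times the product of the drops of the two
  conditional means, which have the same sign.\<close>

theorem harris_inequality: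
  assumes "finite E" "0 \<le> p" "p \<le> 1"
    and "\<And>S T. S \<subseteq> T \<Longrightarrow> T \<subseteq> E \<Longrightarrow> f T \<le> f S"
    and "\<And>S T. S \<subseteq> T \<Longrightarrow> T \<subseteq> E \<Longrightarrow> g T \<le> g S"
  shows "bexp p E f * bexp p E g \<le> bexp p E (\<lambda>S. f S * g S)"
  using assms(1,4,5)
proof (induction E arbitrary: f g rule: finite_induct)
  case (insert x E)
  let ?f1 = "bexp p E (\<lambda>S. f (insert x S))" and ?f0 = "bexp p E f"
  let ?g1 = "bexp p E (\<lambda>S. g (insert x S))" and ?g0 = "bexp p E g"
  have 1: "?f1 * ?g1 \<le> bexp p E (\<lambda>S. f (insert x S) * g (insert x S))"
    by (rule insert.IH) (rule insert.prems, auto)+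
  have 0: "?f0 * ?g0 \<le> bexp p E (\<lambda>S. f S * g S)"
    by (rule insert.IH) (rule insert.prems, auto)+
  have "?f1 \<le> ?f0" "?g1 \<le> ?g0"
    by (intro bexp_mono assms insert.prems; auto)+
  then have "0 \<le> p * (1 - p) * ((?f0 - ?f1) * (?g0 - ?g1))"
    using assms by (intro mult_nonneg_nonneg) auto
  then have "(p * ?f1 + (1 - p) * ?f0) * (p * ?g1 + (1 - p) * ?g0)
     \<le> p * (?f1 * ?g1) + (1 - p) * (?f0 * ?g0)"
    by (simp add: algebra_simps)
  also have "\<dots> \<le> p * bexp p E (\<lambda>S. f (insert x S) * g (insert x S)) + (1 - p) * bexp p E (\<lambda>S. f S * g S)"
    using 0 1 assms by (intro add_mono mult_left_mono) auto
  finally show ?case using insert.hyps by (simp add: bexp_insert)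
qed simp

text \<open>Harris' inequality bounds the logarithmic derivative of the Laplace transform \<open>\<Psi>\<close> of the number
  of events that occur by \<open>- (\<mu> - s * \<Delta>)\<close>.\<close>

theorem janson_inequality:
  fixes A :: "'i \<Rightarrow> 'a set"
  assumes fin: "finite E" "finite J" and p: "0 \<le> p" "p \<le> 1"
    and A: "\<And>j. j \<in> J \<Longrightarrow> A j \<subseteq> E"
    and mu: "\<mu> = (\<Sum>j\<in>J. p ^ card (A j))"
    and Delta: "(\<Sum>j\<in>J. \<Sum>i\<in>{i\<in>J. A i \<inter> A j \<noteq> {}}. p ^ card (A i \<union> A j)) \<le> \<Delta>"
    and pos: "\<Delta> > 0"
  shows "bexp p E (\<lambda>S. of_bool (\<forall>j\<in>J. \<not> A j \<subseteq> S)) \<le> exp (- (\<mu>\<^sup>2 / (2 * \<Delta>)))"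
proof -
  define X where "X S = (\<Sum>j\<in>J. of_bool (A j \<subseteq> S) :: real)" for S
  define \<Psi> where "\<Psi> s = bexp p E (\<lambda>S. exp (- s * X S))" for s
  define \<Psi>' where "\<Psi>' s = bexp p E (\<lambda>S. - X S * exp (- s * X S))" for s
  have deriv: "(\<Psi> has_real_derivative \<Psi>' s) (at s)" for s
    unfolding \<Psi>_def \<Psi>'_def bexp_def
    by (auto intro!: derivative_eq_intros simp: mult_ac)
  have \<Psi>_nonneg: "\<Psi> s \<ge> 0" for s
    unfolding \<Psi>_def by (intro bexp_nonneg p) auto
  \<comment> \<open>Condition on \<open>A j\<close> being contained in the random set. The indices
    whose sets meet \<open>A j\<close> contribute \<open>Y\<close>, the others \<open>Z\<close>.
    Harris' inequality separates the two factors; \<open>exp (- s * Y T)\<close> is bounded below by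
    \<open>1 - s * Y T\<close>, and \<open>Z\<close> has a Laplace transform of at least \<Psi>
    because it counts fewer events.\<close>
  have key: "p ^ card (A j) * \<Psi> s - s * (\<Sum>i\<in>{i\<in>J. A i \<inter> A j \<noteq> {}}. p ^ card (A i \<union> A j)) * \<Psi> s
      \<le> bexp p E (\<lambda>S. of_bool (A j \<subseteq> S) * exp (- s * X S))" if j: "j \<in> J" and s: "s \<ge> 0" for j s
  proof -
    \<comment> \<open>The index \<open>j\<close> itself lies in \<open>I\<close> when
      \<open>A j\<close> is nonempty, so the double sum bounded by \<Delta> contains the diagonal
      terms.\<close>
    define I where "I = {i\<in>J. A i \<inter> A j \<noteq> {}}"
    define Y where "Y T = (\<Sum>i\<in>I. of_bool (A i \<subseteq> A j \<union> T) :: real)" for T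
    define Z where "Z T = (\<Sum>i\<in>J-I. of_bool (A i \<subseteq> T) :: real)" for T
    have I: "I \<subseteq> J" "finite I" using fin by (auto simp: I_def)
    have finj: "finite (E - A j)" using fin by auto
    have mono1: "Y S \<le> Y T" "Z S \<le> Z T" if "S \<subseteq> T" for S T
      unfolding Y_def Z_def using that by (intro sum_mono; auto)+
    have XYZ: "X (A j \<union> T) = Y T + Z T" if "T \<subseteq> E - A j" for T
    proof -
      have "X (A j \<union> T) = Y T + (\<Sum>i\<in>J-I. of_bool (A i \<subseteq> A j \<union> T))"
        unfolding X_def Y_def using sum.subset_diff[OF I(1) fin(2), of "\<lambda>i. of_bool (A i \<subseteq> A j \<union> T) :: real"]
        by simp
      also have "(\<Sum>i\<in>J-I. of_bool (A i \<subseteq> A j \<union> T)) = Z T"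
        unfolding Z_def by (intro sum.cong refl arg_cong[where f=of_bool]) (auto simp: I_def)
      finally show ?thesis .
    qed
    have "\<Psi> s \<le> bexp p E (\<lambda>S. exp (- s * Z (S \<inter> (E - A j))))"
      unfolding \<Psi>_def
    proof (intro bexp_mono p)
      fix S assume "S \<subseteq> E"
      have "Z (S \<inter> (E - A j)) \<le> (\<Sum>i\<in>J-I. of_bool (A i \<subseteq> S))"
        unfolding Z_def by (intro sum_mono) auto
      also have "\<dots> \<le> X S" unfolding X_def using fin by (intro sum_mono2) auto
      finally show "exp (- s * X S) \<le> exp (- s * Z (S \<inter> (E - A j)))"
        using s by (simp add: mult_left_mono)
    qed
    also have "\<dots> = bexp p (E - A j) (\<lambda>T. exp (- s * Z T))"
      by (rule bexp_restrict) (use fin in auto)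
    finally have Zge: "\<Psi> s \<le> bexp p (E - A j) (\<lambda>T. exp (- s * Z T))" .
    have EY: "p ^ card (A j) * bexp p (E - A j) Y = (\<Sum>i\<in>I. p ^ card (A i \<union> A j))"
    proof -
      have "p ^ card (A j) * bexp p (E - A j) Y
         = (\<Sum>i\<in>I. p ^ card (A j) * bexp p (E - A j) (\<lambda>T. of_bool (A i \<subseteq> A j \<union> T)))"
        unfolding Y_def bexp_sum sum_distrib_left ..
      also have "\<dots> = (\<Sum>i\<in>I. p ^ card (A i \<union> A j))"
      proof (rule sum.cong)
        fix i assume i: "i \<in> I"
        then have sub: "A i \<union> A j \<subseteq> E" using I A j by blast
        have "p ^ card (A j) * bexp p (E - A j) (\<lambda>T. of_bool (A i \<subseteq> A j \<union> T))
           = bexp p E (\<lambda>S. of_bool (A j \<subseteq> S) * of_bool (A i \<subseteq> S))"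
          using bexp_superset[OF fin(1) A[OF j], of p "\<lambda>S. of_bool (A i \<subseteq> S)"] by simp
        also have "\<dots> = bexp p E (\<lambda>S. of_bool (A i \<union> A j \<subseteq> S) * 1)"
          by (intro bexp_cong) auto
        also have "\<dots> = p ^ card (A i \<union> A j)"
          using fin by (subst bexp_superset[OF fin(1) sub]) simp
        finally show "p ^ card (A j) * bexp p (E - A j) (\<lambda>T. of_bool (A i \<subseteq> A j \<union> T)) = p ^ card (A i \<union> A j)" .
      qed simp
      finally show ?thesis .
    qed
    have "1 - s * bexp p (E - A j) Y = bexp p (E - A j) (\<lambda>T. 1 - s * Y T)"
      using finj by (simp add: bexp_diff bexp_cmult)
    also have "\<dots> \<le> bexp p (E - A j) (\<lambda>T. exp (- s * Y T))"
      using exp_ge_add_one_self[of "- s * Y _"] by (intro bexp_mono p) simp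
    \<comment> \<open>The linear factor may be negative. It is therefore replaced by the Laplace
      transform of \<open>Y\<close> first, and only then is \<Psi> replaced by that of
      \<open>Z\<close>.\<close>
    finally have "(1 - s * bexp p (E - A j) Y) * \<Psi> s \<le> bexp p (E - A j) (\<lambda>T. exp (- s * Y T)) * \<Psi> s"
      using \<Psi>_nonneg by (rule mult_right_mono)
    also have "\<dots> \<le> bexp p (E - A j) (\<lambda>T. exp (- s * Y T)) * bexp p (E - A j) (\<lambda>T. exp (- s * Z T))"
      using Zge by (intro mult_left_mono bexp_nonneg p) auto
    also have "\<dots> \<le> bexp p (E - A j) (\<lambda>T. exp (- s * Y T) * exp (- s * Z T))"
      using s mono1 by (intro harris_inequality finj p) (auto simp: mult_left_mono)
    also have "\<dots> = bexp p (E - A j) (\<lambda>T. exp (- s * X (A j \<union> T)))"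
      by (intro bexp_cong) (simp add: XYZ exp_add[symmetric] algebra_simps)
    finally have "p ^ card (A j) * ((1 - s * bexp p (E - A j) Y) * \<Psi> s)
        \<le> p ^ card (A j) * bexp p (E - A j) (\<lambda>T. exp (- s * X (A j \<union> T)))"
      using p by (intro mult_left_mono) auto
    also have "\<dots> = bexp p E (\<lambda>S. of_bool (A j \<subseteq> S) * exp (- s * X S))"
      by (rule bexp_superset[OF fin(1) A[OF j], symmetric])
    finally show ?thesis
      unfolding I_def[symmetric] EY[symmetric] by (simp add: algebra_simps)
  qed
  have diff_ineq: "\<Psi>' s + (\<mu> - s * \<Delta>) * \<Psi> s \<le> 0" if s: "s \<ge> 0" for s
  proof -
    let ?D = "\<Sum>j\<in>J. \<Sum>i\<in>{i\<in>J. A i \<inter> A j \<noteq> {}}. p ^ card (A i \<union> A j)"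
    have "(\<mu> - s * \<Delta>) * \<Psi> s \<le> (\<mu> - s * ?D) * \<Psi> s"
      using Delta s \<Psi>_nonneg[of s] by (intro mult_right_mono) (auto simp: mult_left_mono)
    also have "\<dots> = (\<Sum>j\<in>J. p ^ card (A j) * \<Psi> s
        - s * (\<Sum>i\<in>{i\<in>J. A i \<inter> A j \<noteq> {}}. p ^ card (A i \<union> A j)) * \<Psi> s)"
      unfolding mu by (simp add: sum_subtractf sum_distrib_left sum_distrib_right left_diff_distrib)
    also have "\<dots> \<le> (\<Sum>j\<in>J. bexp p E (\<lambda>S. of_bool (A j \<subseteq> S) * exp (- s * X S)))"
      by (intro sum_mono key s)
    also have "\<dots> = bexp p E (\<lambda>S. X S * exp (- s * X S))"
      unfolding bexp_sum[symmetric] X_def sum_distrib_right ..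
    also have "\<dots> = - \<Psi>' s"
      unfolding \<Psi>'_def using bexp_cmult[of p E "-1" "\<lambda>S. X S * exp (- s * X S)"] by simp
    finally show ?thesis by simp
  qed
  \<comment> \<open>An integrating factor for the differential inequality. The point
    \<open>s = \<mu> / \<Delta>\<close> maximises
    \<open>\<mu> * s - \<Delta> * s\<^sup>2 / 2\<close>.\<close>
  define g where "g s = \<Psi> s * exp (\<mu> * s - \<Delta> * s\<^sup>2 / 2)" for s
  define s where "s = \<mu> / \<Delta>"
  have s0: "s \<ge> 0" using pos p unfolding s_def mu by (intro divide_nonneg_pos sum_nonneg) auto
  have "g s \<le> g 0"
  proof (rule DERIV_nonpos_imp_nonincreasing[OF s0])
    fix u assume u: "0 \<le> u" "u \<le> s"
    have "(g has_real_derivative (\<Psi>' u + (\<mu> - u * \<Delta>) * \<Psi> u) * exp (\<mu> * u - \<Delta> * u\<^sup>2 / 2)) (at u)"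
      unfolding g_def
      by (rule derivative_eq_intros deriv refl | simp add: algebra_simps)+
    moreover have "(\<Psi>' u + (\<mu> - u * \<Delta>) * \<Psi> u) * exp (\<mu> * u - \<Delta> * u\<^sup>2 / 2) \<le> 0"
      using diff_ineq[OF u(1)] by (intro mult_nonpos_nonneg) auto
    ultimately show "\<exists>y. (g has_real_derivative y) (at u) \<and> y \<le> 0" by blast
  qed
  also have "g 0 = 1" using fin by (simp add: g_def \<Psi>_def)
  finally have "\<Psi> s \<le> exp (- (\<mu> * s - \<Delta> * s\<^sup>2 / 2))"
    unfolding g_def by (simp add: exp_minus field_simps)
  also have "\<mu> * s - \<Delta> * s\<^sup>2 / 2 = \<mu>\<^sup>2 / (2 * \<Delta>)"
    unfolding s_def using pos by (simp add: field_simps power2_eq_square)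
  finally have *: "\<Psi> s \<le> exp (- (\<mu>\<^sup>2 / (2 * \<Delta>)))" .
  \<comment> \<open>If no event occurs, then \<open>X S = 0\<close> and the integrand of
    \<open>\<Psi> s\<close> is 1.\<close>
  have "bexp p E (\<lambda>S. of_bool (\<forall>j\<in>J. \<not> A j \<subseteq> S)) \<le> \<Psi> s"
    unfolding \<Psi>_def by (intro bexp_mono p) (auto simp: X_def of_bool_def)
  with * show ?thesis by simp
qed

text \<open>This connects the product measure with \<open>bexp\<close>: splitting off one coordinate
  of \<open>Pi_pmf\<close> gives the recursion of \<open>bexp_insert\<close>.\<close>

lemma prob_Pi_bernoulli:
  assumes "finite E" "0 \<le> p" "p \<le> 1"
  shows "measure_pmf.prob (map_pmf (\<lambda>b. {e\<in>E. b e}) (Pi_pmf E False (\<lambda>_. bernoulli_pmf p))) {S. Q S}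
     = bexp p E (\<lambda>S. of_bool (Q S))"
  using assms(1)
proof (induction E arbitrary: Q rule: finite_induct)
  case (insert x E)
  let ?M = "Pi_pmf E False (\<lambda>_. bernoulli_pmf p)"
  let ?P = "map_pmf (\<lambda>b. {e\<in>E. b e}) ?M"
  have "map_pmf (\<lambda>b. {e\<in>insert x E. b e}) (Pi_pmf (insert x E) False (\<lambda>_. bernoulli_pmf p))
     = bernoulli_pmf p \<bind> (\<lambda>y. map_pmf (\<lambda>S. if y then insert x S else S) ?P)"
    unfolding Pi_pmf_insert[OF insert.hyps] map_pmf_comp pair_pmf_def map_bind_pmf map_return_pmf
      bind_map_pmf[symmetric]
    apply (simp add: map_bind_pmf map_pmf_def[symmetric] map_pmf_comp)
    apply (intro bind_pmf_cong refl map_pmf_cong)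
    using insert.hyps by auto
  also have "measure_pmf.prob \<dots> {S. Q S} = p * measure_pmf.prob ?P {S. Q (insert x S)}
      + (1 - p) * measure_pmf.prob ?P {S. Q S}"
  proof -
    have "emeasure (bind_pmf (bernoulli_pmf p) (\<lambda>y. map_pmf (\<lambda>S. if y then insert x S else S) ?P)) {S. Q S}
      = ennreal (p * measure_pmf.prob ?P {S. Q (insert x S)} + (1 - p) * measure_pmf.prob ?P {S. Q S})"
      using assms(2,3)
      by (subst emeasure_bind_pmf)
        (simp add: vimage_def measure_pmf.emeasure_eq_measure ennreal_mult' ennreal_plus mult_ac)
    then show ?thesis
      using assms(2,3) by (intro measure_eq_emeasure_eq_ennreal) auto
  qed
  finally show ?case by (simp only: insert.IH bexp_insert[OF insert.hyps])
qed (simp add: indicator_def)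

section \<open>Transversal cliques in the random graph\<close>

lemma bexp_union_bound:
  assumes "finite I" "0 \<le> p" "p \<le> 1"
  shows "bexp p E (\<lambda>S. of_bool (\<exists>i\<in>I. F i S)) \<le> (\<Sum>i\<in>I. bexp p E (\<lambda>S. of_bool (F i S)))"
proof -
  have "of_bool (\<exists>i\<in>I. F i S) \<le> (\<Sum>i\<in>I. of_bool (F i S) :: real)" for S
  proof (cases "\<exists>i\<in>I. F i S")
    case True
    then obtain i where i: "i \<in> I" "F i S" by blast
    then have "(1::real) = (\<Sum>i\<in>{i}. of_bool (F i S))" by simp
    also have "\<dots> \<le> (\<Sum>i\<in>I. of_bool (F i S))" using i assms(1) by (intro sum_mono2) auto
    finally show ?thesis using True by simp
  qed (simp add: sum_nonneg)
  then show ?thesis unfolding bexp_sum[symmetric] by (intro bexp_mono assms)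
qed

lemma bexp_half_pow:
  assumes "finite F"
  shows "bexp p F (\<lambda>S. (1 / 2) ^ card S) = (1 - p / 2) ^ card F"
  using assms
proof (induction F rule: finite_induct)
  case (insert x F)
  have *: "bexp p F (\<lambda>S. (1 / 2) ^ card (insert x S)) = bexp p F (\<lambda>S. 1 / 2 * (1 / 2) ^ card S)"
  proof (rule bexp_cong)
    fix S assume "S \<subseteq> F"
    then have "card (insert x S) = Suc (card S)"
      using insert.hyps by (intro card_insert_disjoint) (auto intro: finite_subset)
    then show "(1 / 2 :: real) ^ card (insert x S) = 1 / 2 * (1 / 2) ^ card S" by simp
  qed
  show ?case
    unfolding bexp_insert[OF insert.hyps] * bexp_cmult insert.IH
    using insert.hyps by (simp add: algebra_simps)
qed simp

text \<open>Chernoff's method with base \<open>1 / 2\<close>: Markov's inequality for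
  \<open>2 ^ k * (1 / 2) ^ card (S \<inter> F)\<close>. Replacing \<open>2 ^ k\<close> by
  \<open>exp k\<close> costs at most half of the exponent \<open>p * card F / 2\<close>.\<close>

lemma bexp_few_edges:
  fixes p :: real
  assumes "finite E" "F \<subseteq> E" "0 \<le> p" "p \<le> 1" "real k \<le> p * card F / 4"
  shows "bexp p E (\<lambda>S. of_bool (card (S \<inter> F) \<le> k)) \<le> exp (- (p * card F / 4))"
proof -
  have finF: "finite F" using assms finite_subset by blast
  have "bexp p E (\<lambda>S. of_bool (card (S \<inter> F) \<le> k)) \<le> bexp p E (\<lambda>S. 2 ^ k * (1 / 2) ^ card (S \<inter> F))"
  proof (intro bexp_mono assms)
    fix S
    show "of_bool (card (S \<inter> F) \<le> k) \<le> (2 ^ k * (1 / 2) ^ card (S \<inter> F) :: real)"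
    proof (cases "card (S \<inter> F) \<le> k")
      case True
      then have "(2::real) ^ card (S \<inter> F) \<le> 2 ^ k" by (intro power_increasing) auto
      then show ?thesis using True by (simp add: power_one_over field_simps)
    qed simp
  qed
  also have "\<dots> = 2 ^ k * (1 - p / 2) ^ card F"
    by (simp add: bexp_cmult bexp_restrict[OF assms(1,2), of p "\<lambda>S. (1 / 2) ^ card S"]
        bexp_half_pow[OF finF])
  also have "\<dots> \<le> exp (real k) * exp (- (p * card F / 2))"
  proof (rule mult_mono)
    have "(2::real) \<le> exp 1" using exp_ge_add_one_self[of "1::real"] by simp
    then have "(2::real) ^ k \<le> exp 1 ^ k" by (intro power_mono) auto
    then show "(2::real) ^ k \<le> exp (real k)" by (simp flip: exp_of_nat_mult)
    have "1 - p / 2 \<le> exp (- (p / 2))" using exp_ge_add_one_self[of "- (p / 2)"] by simp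
    then have "(1 - p / 2) ^ card F \<le> exp (- (p / 2)) ^ card F" using assms by (intro power_mono) auto
    then show "(1 - p / 2) ^ card F \<le> exp (- (p * card F / 2))"
      by (simp add: field_simps flip: exp_of_nat_mult)
  qed (use assms in auto)
  also have "\<dots> \<le> exp (- (p * card F / 4))"
    using assms(5) by (simp flip: exp_add)
  finally show ?thesis .
qed

definition nbrs :: "'a set set \<Rightarrow> 'a \<Rightarrow> 'a set \<Rightarrow> 'a set" where
  "nbrs S v B = {w\<in>B. {v, w} \<in> S}"

text \<open>If every degree is below \<open>d\<close>, then at most \<open>card M * (d - 1)\<close>
  edges run between \<open>M\<close> and \<open>B\<close>, so a single tail bound covers all
  vertices at once. The exponent contains the product of both sizes, which pays for the choice of
  \<open>M\<close> and \<open>B\<close> in the union bound.\<close>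

lemma bexp_small_degrees:
  fixes p :: real
  assumes E: "finite E" and fin: "finite M" "finite B" and disj: "M \<inter> B = {}"
    and sub: "\<And>v w. v \<in> M \<Longrightarrow> w \<in> B \<Longrightarrow> {v, w} \<in> E"
    and p: "0 \<le> p" "p \<le> 1" and d: "d \<ge> 1" "real d - 1 \<le> p * card B / 4"
  shows "bexp p E (\<lambda>S. of_bool (\<forall>v\<in>M. card (nbrs S v B) < d)) \<le> exp (- (p * card M * card B / 4))"
proof -
  define F where "F = (\<lambda>(v, w). {v, w}) ` (M \<times> B)"
  have inj: "inj_on (\<lambda>(v, w). {v, w}) (M \<times> B)"
    using disj by (auto simp: inj_on_def doubleton_eq_iff)
  have cF: "card F = card M * card B"
    unfolding F_def by (simp add: card_image[OF inj] card_cartesian_product)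
  have FE: "F \<subseteq> E" using sub unfolding F_def by auto
  define k where "k = card M * (d - 1)"
  have "real k = card M * (real d - 1)" unfolding k_def using d by (simp add: of_nat_diff)
  also have "\<dots> \<le> card M * (p * card B / 4)" by (intro mult_left_mono d) auto
  finally have k: "real k \<le> p * card F / 4" by (simp add: cF mult_ac)
  have few: "card (S \<inter> F) \<le> k" if S: "\<forall>v\<in>M. card (nbrs S v B) < d" for S
  proof -
    have "S \<inter> F \<subseteq> (\<Union>v\<in>M. (\<lambda>w. {v, w}) ` nbrs S v B)"
      unfolding F_def nbrs_def by auto
    then have "card (S \<inter> F) \<le> card (\<Union>v\<in>M. (\<lambda>w. {v, w}) ` nbrs S v B)"
      using fin by (intro card_mono) (auto simp: nbrs_def)
    also have "\<dots> \<le> (\<Sum>v\<in>M. card ((\<lambda>w. {v, w}) ` nbrs S v B))"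
      using fin by (intro card_UN_le)
    also have "\<dots> \<le> (\<Sum>v\<in>M. d - 1)"
    proof (rule sum_mono)
      fix v assume v: "v \<in> M"
      have "card ((\<lambda>w. {v, w}) ` nbrs S v B) \<le> card (nbrs S v B)"
        using fin by (intro card_image_le) (auto simp: nbrs_def)
      then show "card ((\<lambda>w. {v, w}) ` nbrs S v B) \<le> d - 1" using S v by fastforce
    qed
    finally show ?thesis by (simp add: k_def)
  qed
  have "bexp p E (\<lambda>S. of_bool (\<forall>v\<in>M. card (nbrs S v B) < d)) \<le> bexp p E (\<lambda>S. of_bool (card (S \<inter> F) \<le> k))"
    using few by (intro bexp_mono p) auto
  also have "\<dots> \<le> exp (- (p * card F / 4))"
    by (rule bexp_few_edges[OF E FE p k])
  finally show ?thesis by (simp add: cF mult_ac)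
qed

section \<open>Cliques as edge sets, and Janson's inequality for transversals\<close>

lemma finite_pairs [simp]: "finite V \<Longrightarrow> finite (pairs V)"
  unfolding pairs_def by simp

lemma card_pairs: "finite V \<Longrightarrow> card (pairs V) = card V choose 2"
  unfolding pairs_def by (rule n_subsets)

lemma pairs_Int: "pairs A \<inter> pairs B = pairs (A \<inter> B)"
  unfolding pairs_def by auto

lemma pairs_mono: "A \<subseteq> B \<Longrightarrow> pairs A \<subseteq> pairs B"
  unfolding pairs_def by auto

lemma doubleton_in_pairs: "{u, v} \<in> pairs V \<longleftrightarrow> u \<in> V \<and> v \<in> V \<and> u \<noteq> v"
  unfolding pairs_def by (auto simp: card_2_iff doubleton_eq_iff)

lemma pairs_insert:
  assumes "v \<notin> X"
  shows "pairs (insert v X) \<subseteq> S \<longleftrightarrow> pairs X \<subseteq> S \<and> (\<forall>w\<in>X. {v, w} \<in> S)"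
proof
  assume "pairs (insert v X) \<subseteq> S"
  then show "pairs X \<subseteq> S \<and> (\<forall>w\<in>X. {v, w} \<in> S)"
    using assms doubleton_in_pairs[of v _ "insert v X"] pairs_mono[of X "insert v X"] by auto
next
  assume S: "pairs X \<subseteq> S \<and> (\<forall>w\<in>X. {v, w} \<in> S)"
  show "pairs (insert v X) \<subseteq> S"
  proof
    fix e assume "e \<in> pairs (insert v X)"
    then obtain a b where ab: "e = {a, b}" "a \<noteq> b" "a \<in> insert v X" "b \<in> insert v X"
      unfolding pairs_def card_2_iff by blast
    then consider "a = v" "b \<in> X" | "b = v" "a \<in> X" | "a \<in> X" "b \<in> X" by auto
    then show "e \<in> S"
    proof cases
      case 3
      then have "e \<in> pairs X" using ab doubleton_in_pairs[of a b X] by blast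
      then show ?thesis using S by blast
    qed (use S ab insert_commute[of a b "{}"] in auto)
  qed
qed

text \<open>Two transversal cliques share an edge only if they belong to the same index \<open>i\<close> and agree
  in at least two coordinates.\<close>

theorem janson_transversal:
  fixes D :: "nat \<Rightarrow> nat \<Rightarrow> 'a set"
  assumes r: "r \<ge> 2" and t: "t \<ge> 1" and p: "0 < p" "p \<le> 1"
    and fin: "finite E"
    and D: "\<And>i j. i < t \<Longrightarrow> j < r \<Longrightarrow> finite (D i j) \<and> card (D i j) = d"
    and disj: "\<And>i j i' j'. i < t \<Longrightarrow> j < r \<Longrightarrow> i' < t \<Longrightarrow> j' < r \<Longrightarrow> D i j \<inter> D i' j' \<noteq> {} \<Longrightarrow> i = i' \<and> j = j'"
    and sub: "\<And>i x. i < t \<Longrightarrow> x \<in> PiE {..<r} (D i) \<Longrightarrow> pairs (x ` {..<r}) \<subseteq> E"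
    and L: "L > 0" "\<And>k. 2 \<le> k \<Longrightarrow> k \<le> r \<Longrightarrow> L \<le> real d ^ k * p ^ (k choose 2)"
  shows "bexp p E (\<lambda>S. of_bool (\<forall>i<t. \<forall>x\<in>PiE {..<r} (D i). \<not> pairs (x ` {..<r}) \<subseteq> S))
    \<le> exp (- (real t * L / 2 ^ (r + 1)))"
proof -
  define J where "J = Sigma {..<t} (\<lambda>i. PiE {..<r} (D i))"
  define A where "A = (\<lambda>(i::nat, x :: nat \<Rightarrow> 'a). pairs (x ` {..<r}))"
  define e where "e = r choose 2"
  define G where "G i = PiE {..<r} (D i)" for i
  have d0: "d > 0"
  proof (rule ccontr)
    assume "\<not> d > 0"
    then show False using L(1) L(2)[of 2] r by simp
  qed
  have finG: "finite (G i)" if "i < t" for i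
    unfolding G_def using D that by (intro finite_PiE) auto
  have cardG: "card (G i) = d ^ r" if "i < t" for i
    unfolding G_def using D that by (subst card_PiE) auto
  have finJ: "finite J" unfolding J_def using finG by (auto simp: G_def)
  have xD: "x j \<in> D i j" if "x \<in> G i" "j < r" for x i j using that unfolding G_def by auto
  have inj: "inj_on x {..<r}" if "x \<in> G i" "i < t" for x i
    using xD that disj[of i _ i] by (intro inj_onI) (metis IntI empty_iff lessThan_iff)
  have cardA: "card (A (i, x)) = e" if "x \<in> G i" "i < t" for i x
    unfolding A_def e_def by (simp add: card_pairs card_image[OF inj[OF that]])
  \<comment> \<open>This bounds the contribution of one clique to the overlap sum. The other clique
    \<open>y\<close> is classified by the set \<open>I y\<close> of coordinates where it agrees with
    \<open>x\<close>.\<close>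
  have inner: "(\<Sum>j'\<in>{j'\<in>J. A j' \<inter> A (i, x) \<noteq> {}}. p ^ card (A j' \<union> A (i, x)))
      \<le> p ^ (2 * e) / L * (2 ^ r * real d ^ r)" if x: "x \<in> G i" and i: "i < t" for i x
  proof -
    define I where "I y = {j. j < r \<and> x j = y j}" for y
    have finI: "finite (I y)" for y unfolding I_def by simp
    have Isub: "I y \<subseteq> {..<r}" for y unfolding I_def by auto
    have common: "x ` {..<r} \<inter> y ` {..<r} = x ` I y" if y: "y \<in> G i" for y
    proof
      show "x ` {..<r} \<inter> y ` {..<r} \<subseteq> x ` I y"
      proof
        fix u assume "u \<in> x ` {..<r} \<inter> y ` {..<r}"
        then obtain j j' where j: "j < r" "j' < r" "u = x j" "u = y j'" by auto
        then have "D i j \<inter> D i j' \<noteq> {}" using xD[OF x] xD[OF y] by (metis IntI empty_iff)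
        then have "j = j'" using disj i j by blast
        then have "j \<in> I y" using j unfolding I_def by auto
        then show "u \<in> x ` I y" using j(3) by blast
      qed
      have "x j = y j" "j \<in> {..<r}" if "j \<in> I y" for j using that unfolding I_def by auto
      then show "x ` I y \<subseteq> x ` {..<r} \<inter> y ` {..<r}" by (metis IntI image_eqI image_subsetI)
    qed
    define H where "H = {y\<in>G i. 2 \<le> card (I y)}"
    have sub1: "{j'\<in>J. A j' \<inter> A (i, x) \<noteq> {}} \<subseteq> Pair i ` H"
    proof
      fix j' assume "j' \<in> {j'\<in>J. A j' \<inter> A (i, x) \<noteq> {}}"
      then obtain i' y where j': "j' = (i', y)" "i' < t" "y \<in> G i'" and "A (i', y) \<inter> A (i, x) \<noteq> {}"
        unfolding J_def G_def by auto
      then obtain f where "f \<in> A (i', y)" "f \<in> A (i, x)" by blast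
      then have f: "card f = 2" "f \<subseteq> y ` {..<r}" "f \<subseteq> x ` {..<r}"
        unfolding A_def pairs_def by auto
      then obtain u where u: "u \<in> f" by fastforce
      obtain j1 where j1: "j1 < r" "u = y j1" using u f(2) by auto
      obtain j2 where j2: "j2 < r" "u = x j2" using u f(3) by auto
      have "u \<in> D i' j1" "u \<in> D i j2" using xD[OF x j2(1)] xD[OF j'(3) j1(1)] j1(2) j2(2) by auto
      then have ii: "i' = i" using disj[OF j'(2) j1(1) i j2(1)] by blast
      have "f \<subseteq> x ` I y" using f(2,3) common[of y] j'(3) ii by auto
      then have "2 \<le> card (x ` I y)" using f(1) finI by (metis card_mono finite_imageI)
      also have "\<dots> \<le> card (I y)" using finI by (rule card_image_le)
      finally show "j' \<in> Pair i ` H" using j' ii unfolding H_def by auto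
    qed
    \<comment> \<open>With \<open>k = card (I y)\<close>, the union has
      \<open>2 * e - (k choose 2)\<close> edges. The hypothesis on \<open>L\<close> bounds the
      resulting factor \<open>1 / p ^ (k choose 2)\<close> by \<open>real d ^ k / L\<close>.\<close>
    have term_bd: "p ^ card (A (i, y) \<union> A (i, x)) \<le> p ^ (2 * e) / L * real d ^ card (I y)" if y: "y \<in> H" for y
    proof -
      have yG: "y \<in> G i" "2 \<le> card (I y)" using y unfolding H_def by auto
      have k: "card (I y) \<le> r" using card_mono[OF _ Isub[of y]] by simp
      have "A (i, y) \<inter> A (i, x) = pairs (x ` I y)"
        using common[OF yG(1)] by (simp add: A_def pairs_Int Int_commute)
      moreover have "card (x ` I y) = card (I y)"
        using inj[OF x i] Isub by (meson card_image inj_on_subset)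
      ultimately have cI: "card (A (i, y) \<inter> A (i, x)) = card (I y) choose 2"
        by (simp add: card_pairs finI)
      have "card (A (i, y)) + card (A (i, x)) = card (A (i, y) \<union> A (i, x)) + card (A (i, y) \<inter> A (i, x))"
        by (rule card_Un_Int) (auto simp: A_def)
      then have "2 * e = card (A (i, y) \<union> A (i, x)) + (card (I y) choose 2)"
        using cI cardA[OF x i] cardA[OF yG(1) i] by simp
      then have eq: "p ^ (2 * e) = p ^ card (A (i, y) \<union> A (i, x)) * p ^ (card (I y) choose 2)"
        by (simp add: power_add)
      have "p ^ card (A (i, y) \<union> A (i, x)) * L
          \<le> p ^ card (A (i, y) \<union> A (i, x)) * (real d ^ card (I y) * p ^ (card (I y) choose 2))"
        using p by (intro mult_left_mono L yG k) auto
      also have "\<dots> = p ^ (2 * e) * real d ^ card (I y)" unfolding eq by (simp add: mult_ac)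
      finally show ?thesis using L(1) by (simp add: field_simps)
    qed
    have count: "card {y\<in>G i. I y = K} \<le> d ^ (r - card K)" if K: "K \<subseteq> {..<r}" for K
    proof -
      have "{y\<in>G i. I y = K} \<subseteq> PiE {..<r} (\<lambda>j. if j \<in> K then {x j} else D i j)"
      proof
        fix y assume "y \<in> {y\<in>G i. I y = K}"
        then have y: "y \<in> PiE {..<r} (D i)" "\<And>j. j \<in> K \<Longrightarrow> x j = y j"
          unfolding G_def I_def by auto
        show "y \<in> PiE {..<r} (\<lambda>j. if j \<in> K then {x j} else D i j)"
          by (rule PiE_I) (use y(2) PiE_mem[OF y(1)] PiE_arb[OF y(1)] in auto)
      qed
      then have "card {y\<in>G i. I y = K} \<le> card (PiE {..<r} (\<lambda>j. if j \<in> K then {x j} else D i j))"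
        using D i by (intro card_mono finite_PiE) auto
      also have "\<dots> = (\<Prod>j<r. if j \<in> K then 1 else d)"
        unfolding card_PiE[OF finite_lessThan] by (rule prod.cong) (use D i in auto)
      also have "\<dots> = d ^ card ({..<r} - K)"
        by (subst prod.If_cases) (auto simp: Diff_eq Int_commute)
      also have "card ({..<r} - K) = r - card K"
        using K by (subst card_Diff_subset) (auto intro: finite_subset)
      finally show ?thesis .
    qed
    have "(\<Sum>j'\<in>{j'\<in>J. A j' \<inter> A (i, x) \<noteq> {}}. p ^ card (A j' \<union> A (i, x)))
       \<le> (\<Sum>j'\<in>Pair i ` H. p ^ card (A j' \<union> A (i, x)))"
      using sub1 p finG[OF i] by (intro sum_mono2) (auto simp: H_def)
    also have "\<dots> = (\<Sum>y\<in>H. p ^ card (A (i, y) \<union> A (i, x)))"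
      by (subst sum.reindex) (auto simp: inj_on_def)
    also have "\<dots> \<le> (\<Sum>y\<in>H. p ^ (2 * e) / L * real d ^ card (I y))"
      by (intro sum_mono term_bd)
    also have "\<dots> \<le> (\<Sum>y\<in>G i. p ^ (2 * e) / L * real d ^ card (I y))"
      using finG[OF i] p L(1) by (intro sum_mono2) (auto simp: H_def)
    also have "\<dots> = p ^ (2 * e) / L * (\<Sum>y\<in>G i. real d ^ card (I y))"
      by (simp add: sum_distrib_left)
    \<comment> \<open>For each agreement set \<open>K\<close> there are at most
      \<open>d ^ (r - card K)\<close> choices of \<open>y\<close>, each of weight
      \<open>d ^ card K\<close>. Thus each of the \<open>2 ^ r\<close> sets \<open>K\<close> costs
      at most \<open>d ^ r\<close>.\<close>
    also have "(\<Sum>y\<in>G i. real d ^ card (I y)) = (\<Sum>K\<in>Pow {..<r}. \<Sum>y\<in>{y\<in>G i. I y = K}. real d ^ card (I y))"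
      using finG[OF i] Isub by (intro sum.group[symmetric]) auto
    also have "\<dots> \<le> (\<Sum>K\<in>Pow {..<r}. real d ^ r)"
    proof (rule sum_mono)
      fix K assume K: "K \<in> Pow {..<r}"
      then have kr: "card K \<le> r" using card_mono[of "{..<r}" K] by auto
      have "(\<Sum>y\<in>{y\<in>G i. I y = K}. real d ^ card (I y)) = real (card {y\<in>G i. I y = K}) * real d ^ card K"
        by simp
      also have "\<dots> \<le> real (d ^ (r - card K)) * real d ^ card K"
        using count[of K] K by (intro mult_right_mono) (auto simp del: of_nat_power)
      also have "\<dots> = real d ^ r" using kr by (simp flip: power_add)
      finally show "(\<Sum>y\<in>{y\<in>G i. I y = K}. real d ^ card (I y)) \<le> real d ^ r" .
    qed
    also have "\<dots> = 2 ^ r * real d ^ r" by (simp add: card_Pow)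
    finally show ?thesis using p L(1) by (simp add: mult_left_mono divide_right_mono)
  qed
  \<comment> \<open>The factor \<open>t\<close> appears once in \<Delta>, as cliques of different
    stars share no edge, but twice in the square of \<mu>. Hence the exponent is linear in
    \<open>t\<close>.\<close>
  define \<Delta> where "\<Delta> = real t * real d ^ r * (p ^ (2 * e) / L * (2 ^ r * real d ^ r))"
  define \<mu> where "\<mu> = real t * real d ^ r * p ^ e"
  have sumJ: "(\<Sum>j\<in>J. f j) = (\<Sum>i<t. \<Sum>x\<in>G i. f (i, x))" for f :: "nat \<times> (nat \<Rightarrow> 'a) \<Rightarrow> real"
    unfolding J_def G_def[symmetric] using finG by (subst sum.Sigma) auto
  have "bexp p E (\<lambda>S. of_bool (\<forall>j\<in>J. \<not> A j \<subseteq> S)) \<le> exp (- (\<mu>\<^sup>2 / (2 * \<Delta>)))"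
  proof (rule janson_inequality[OF fin finJ])
    show "\<mu> = (\<Sum>j\<in>J. p ^ card (A j))"
      unfolding sumJ by (simp add: cardA cardG \<mu>_def)
    show "(\<Sum>j\<in>J. \<Sum>i\<in>{i\<in>J. A i \<inter> A j \<noteq> {}}. p ^ card (A i \<union> A j)) \<le> \<Delta>"
    proof -
      have "(\<Sum>j\<in>J. \<Sum>i\<in>{i\<in>J. A i \<inter> A j \<noteq> {}}. p ^ card (A i \<union> A j))
        \<le> (\<Sum>i<t. \<Sum>x\<in>G i. p ^ (2 * e) / L * (2 ^ r * real d ^ r))"
        unfolding sumJ by (intro sum_mono inner) auto
      also have "\<dots> = \<Delta>" by (simp add: cardG \<Delta>_def)
      finally show ?thesis .
    qed
    show "\<Delta> > 0" unfolding \<Delta>_def using t p d0 L(1) by simp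
    show "A j \<subseteq> E" if "j \<in> J" for j using that sub unfolding J_def A_def by auto
  qed (use p in auto)
  also have "\<mu>\<^sup>2 / (2 * \<Delta>) = real t * L / 2 ^ (r + 1)"
    unfolding \<mu>_def \<Delta>_def using t p d0 L(1)
    by (simp add: field_simps power2_eq_square power_add power_mult)
  also have "(\<lambda>S. of_bool (\<forall>j\<in>J. \<not> A j \<subseteq> S)) = (\<lambda>S. of_bool (\<forall>i<t. \<forall>x\<in>PiE {..<r} (D i). \<not> pairs (x ` {..<r}) \<subseteq> S) :: real)"
    unfolding J_def A_def by (intro ext arg_cong[where f=of_bool]) auto
  finally show ?thesis .
qed

section \<open>Disjoint stars and exposure in two rounds\<close>

text \<open>The property concerns a single part \<open>B\<close>, so its failure is witnessed by one
  pair \<open>M'\<close>, \<open>B'\<close>, and the union bound runs over such pairs only.\<close>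

definition rich :: "nat \<Rightarrow> nat \<Rightarrow> nat \<Rightarrow> 'a set set \<Rightarrow> 'a set \<Rightarrow> 'a set \<Rightarrow> bool" where
  "rich m b d S M B \<longleftrightarrow> (\<forall>M'\<subseteq>M. \<forall>B'\<subseteq>B. card M' = m \<and> card B' = b \<longrightarrow> (\<exists>v\<in>M'. d \<le> card (nbrs S v B')))"

lemma rich_few_poor:
  assumes "rich m b d S M B" "B' \<subseteq> B" "card B' = b" "finite M"
  shows "card {v\<in>M. card (nbrs S v B') < d} \<le> m"
proof (rule ccontr)
  assume "\<not> ?thesis"
  then obtain M' where M': "M' \<subseteq> {v\<in>M. card (nbrs S v B') < d}" "card M' = m"
    using obtain_subset_with_card_n[of m "{v\<in>M. card (nbrs S v B') < d}"] by auto
  then obtain v where "v \<in> M'" "d \<le> card (nbrs S v B')"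
    using assms unfolding rich_def by (metis (no_types, lifting) mem_Collect_eq subset_eq)
  then show False using M' by auto
qed

text \<open>Greedy choice. The earlier stars occupy at most \<open>b\<close> vertices of each
  \<open>B j\<close>, so \<open>b\<close> vertices are still free. At most \<open>m\<close> vertices
  of \<open>M\<close> are poor for each free part, and \<open>r * m < card M\<close> leaves a centre
  that is good for all of them. Centres may coincide; only the leaf sets \<open>D i j\<close> are
  kept apart.\<close>

lemma rich_disjoint_stars:
  fixes B :: "nat \<Rightarrow> 'a set"
  assumes finM: "finite M" and B: "\<And>j. j < r \<Longrightarrow> finite (B j) \<and> 2 * b \<le> card (B j)"
    and rich: "\<And>j. j < r \<Longrightarrow> rich m b d S M (B j)"
    and M: "r * m < card M" and t: "t * d \<le> b"
  shows "\<exists>v D. \<forall>i<t. v i \<in> M \<and> (\<forall>j<r. D i j \<subseteq> nbrs S (v i) (B j) \<and> card (D i j) = d \<and>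
     (\<forall>i'<i. D i j \<inter> D i' j = {}))"
  using t
proof (induction t)
  case (Suc t)
  then obtain v D where vD: "\<And>i. i < t \<Longrightarrow> v i \<in> M \<and> (\<forall>j<r. D i j \<subseteq> nbrs S (v i) (B j) \<and> card (D i j) = d \<and>
     (\<forall>i'<i. D i j \<inter> D i' j = {}))" by auto
  define F where "F j = (\<Union>i<t. D i j)" for j
  have "\<exists>B'. B' \<subseteq> B j - F j \<and> card B' = b" if j: "j < r" for j
  proof -
    have "card (F j) \<le> (\<Sum>i<t. card (D i j))" unfolding F_def by (rule card_UN_le) simp
    also have "\<dots> = t * d" using vD j by simp
    finally have "card (F j) \<le> b" using Suc.prems by simp
    moreover have "F j \<subseteq> B j"
      unfolding F_def using vD j unfolding nbrs_def by blast
    then have "finite (F j)" using B[OF j] finite_subset by blast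
    ultimately have "b \<le> card (B j - F j)"
      using B[OF j] diff_card_le_card_Diff[of "F j" "B j"] by linarith
    then show ?thesis by (meson obtain_subset_with_card_n)
  qed
  then obtain B' where B': "\<And>j. j < r \<Longrightarrow> B' j \<subseteq> B j - F j \<and> card (B' j) = b" by metis
  define poor where "poor j = {v\<in>M. card (nbrs S v (B' j)) < d}" for j
  have "card (\<Union>j<r. poor j) \<le> (\<Sum>j<r. card (poor j))" by (rule card_UN_le) simp
  also have "\<dots> \<le> (\<Sum>j<r. m)"
    unfolding poor_def using B' by (intro sum_mono rich_few_poor[OF rich _ _ finM]) auto
  finally have "card (\<Union>j<r. poor j) < card M" using M by simp
  moreover have "finite (\<Union>j<r. poor j)" unfolding poor_def using finM by auto
  ultimately obtain u where u: "u \<in> M" "u \<notin> (\<Union>j<r. poor j)"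
    by (meson card_mono not_less subsetI)
  have "\<exists>X. X \<subseteq> nbrs S u (B' j) \<and> card X = d" if j: "j < r" for j
  proof -
    have "u \<notin> poor j" using u(2) j by simp
    then have "d \<le> card (nbrs S u (B' j))" using u(1) by (simp add: poor_def)
    then show ?thesis by (metis obtain_subset_with_card_n)
  qed
  then obtain X where X: "\<And>j. j < r \<Longrightarrow> X j \<subseteq> nbrs S u (B' j) \<and> card (X j) = d" by metis
  show ?case
  proof (intro exI allI impI)
    fix i assume i: "i < Suc t"
    let ?v = "v(t := u)" and ?D = "D(t := X)"
    show "?v i \<in> M \<and> (\<forall>j<r. ?D i j \<subseteq> nbrs S (?v i) (B j) \<and> card (?D i j) = d \<and>
     (\<forall>i'<i. ?D i j \<inter> ?D i' j = {}))"
    proof (cases "i = t")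
      case True
      have "X j \<subseteq> nbrs S u (B j)" "X j \<inter> D i' j = {}" if "j < r" "i' < t" for j i'
        using X[OF that(1)] B'[OF that(1)] that(2) unfolding nbrs_def F_def by auto
      moreover have "X j \<subseteq> nbrs S u (B j)" if "j < r" for j
        using X[OF that] B'[OF that] unfolding nbrs_def by auto
      ultimately show ?thesis using True u X by simp
    next
      case False
      then show ?thesis using vD[of i] i by simp
    qed
  qed
qed simp

definition has_transversal :: "'a set set \<Rightarrow> nat \<Rightarrow> 'a set \<Rightarrow> (nat \<Rightarrow> 'a set) \<Rightarrow> bool" where
  "has_transversal S r M B \<longleftrightarrow> (\<exists>v\<in>M. \<exists>x\<in>PiE {..<r} B. pairs (insert v (x ` {..<r})) \<subseteq> S)"

text \<open>The edges in \<open>E1\<close> decide richness and determine the stars. The edges in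
  \<open>E2\<close>, inside the union of the parts, are independent of them, and a transversal
  clique on the leaves of one star extends by the centre to the desired clique.\<close>

lemma bexp_rich_no_transversal:
  fixes B :: "nat \<Rightarrow> 'a set"
  assumes r: "r \<ge> 2" and t: "t \<ge> 1" "t * d \<le> b" and p: "0 < p" "p \<le> 1"
    and V: "finite V" "M \<subseteq> V" "\<And>j. j < r \<Longrightarrow> B j \<subseteq> V"
    and disj: "\<And>j. j < r \<Longrightarrow> M \<inter> B j = {}" "\<And>j j'. j < j' \<Longrightarrow> j' < r \<Longrightarrow> B j \<inter> B j' = {}"
    and cards: "r * m < card M" "\<And>j. j < r \<Longrightarrow> 2 * b \<le> card (B j)"
    and L: "L > 0" "\<And>k. 2 \<le> k \<Longrightarrow> k \<le> r \<Longrightarrow> L \<le> real d ^ k * p ^ (k choose 2)"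
  shows "bexp p (pairs V) (\<lambda>S. of_bool ((\<forall>j<r. rich m b d S M (B j)) \<and> \<not> has_transversal S r M B))
    \<le> exp (- (real t * L / 2 ^ (r + 1)))" (is "?P \<le> ?R")
proof -
  define E2 where "E2 = pairs (\<Union>j<r. B j)"
  define E1 where "E1 = pairs V - E2"
  have finV: "finite (pairs V)" using V by simp
  have E2: "E2 \<subseteq> pairs V" unfolding E2_def using V by (intro pairs_mono) auto
  have fin: "finite E1" "finite E2" using finV E2 finite_subset unfolding E1_def by auto
  have un: "pairs V = E1 \<union> E2" "E1 \<inter> E2 = {}" using E2 unfolding E1_def by auto
  define bad where "bad S \<longleftrightarrow> (\<forall>j<r. rich m b d S M (B j)) \<and> \<not> has_transversal S r M B" for S
  have finB: "finite (B j)" if "j < r" for j using V that finite_subset by blast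
  have finM: "finite M" using V finite_subset by blast
  have BB: "j = j'" if "j < r" "j' < r" "B j \<inter> B j' \<noteq> {}" for j j'
    using disj(2)[of j j'] disj(2)[of j' j] that by (metis Int_commute nat_neq_iff)
  have inner: "bexp p E2 (\<lambda>T. of_bool (bad (S \<union> T))) \<le> ?R" if S: "S \<subseteq> E1" for S
  proof (cases "\<forall>j<r. rich m b d S M (B j)")
    case False
    then obtain j where j: "j < r" "\<not> rich m b d S M (B j)" by blast
    \<comment> \<open>Vertices of \<open>M\<close> lie outside the parts, so edges of
      \<open>E2\<close> do not affect their neighbourhoods, and richness fails for every
      \<open>T\<close>.\<close>
    have "\<not> bad (S \<union> T)" if T: "T \<subseteq> E2" for T
    proof -
      have "nbrs (S \<union> T) v B' = nbrs S v B'" if "v \<in> M" "B' \<subseteq> B j" for v B'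
      proof -
        have "{v, w} \<notin> T" for w
          using T \<open>v \<in> M\<close> disj(1) doubleton_in_pairs[of v w "\<Union>j<r. B j"] unfolding E2_def by blast
        then show ?thesis unfolding nbrs_def by blast
      qed
      then have "rich m b d (S \<union> T) M (B j) \<longleftrightarrow> rich m b d S M (B j)"
        unfolding rich_def by (metis subsetD)
      then show ?thesis using j unfolding bad_def by blast
    qed
    then have "bexp p E2 (\<lambda>T. of_bool (bad (S \<union> T))) \<le> bexp p E2 (\<lambda>_. 0)"
      using p by (intro bexp_mono) auto
    then show ?thesis using fin by (simp add: order_trans[OF _ exp_ge_zero])
  next
    case True
    have "\<exists>v D. \<forall>i<t. v i \<in> M \<and> (\<forall>j<r. D i j \<subseteq> nbrs S (v i) (B j) \<and> card (D i j) = d \<and>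
     (\<forall>i'<i. D i j \<inter> D i' j = {}))"
      using finB cards True t by (intro rich_disjoint_stars[OF finM]) auto
    then obtain v D where vD: "\<And>i. i < t \<Longrightarrow> v i \<in> M \<and> (\<forall>j<r. D i j \<subseteq> nbrs S (v i) (B j) \<and> card (D i j) = d \<and>
     (\<forall>i'<i. D i j \<inter> D i' j = {}))" by blast
    have DB: "D i j \<subseteq> B j" if "i < t" "j < r" for i j using vD that unfolding nbrs_def by blast
    have "bexp p E2 (\<lambda>T. of_bool (bad (S \<union> T)))
       \<le> bexp p E2 (\<lambda>T. of_bool (\<forall>i<t. \<forall>x\<in>PiE {..<r} (D i). \<not> pairs (x ` {..<r}) \<subseteq> T))"
    proof (rule bexp_mono)
      fix T
      have "has_transversal (S \<union> T) r M B" if "i < t" "x \<in> PiE {..<r} (D i)" "pairs (x ` {..<r}) \<subseteq> T" for i x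
      proof -
        have xj: "x j \<in> nbrs S (v i) (B j)" if "j < r" for j
          using vD[OF \<open>i < t\<close>] that PiE_mem[OF \<open>x \<in> PiE {..<r} (D i)\<close>, of j] by auto
        have vM: "v i \<in> M" using vD that by blast
        have xB: "x j \<in> B j" "{v i, x j} \<in> S" if "j < r" for j
          using xj[OF that] unfolding nbrs_def by auto
        have "v i \<notin> x ` {..<r}"
        proof
          assume "v i \<in> x ` {..<r}"
          then obtain j where "j < r" "v i = x j" by auto
          then show False using xB(1)[of j] vM disj(1)[of j] by auto
        qed
        then have "pairs (insert (v i) (x ` {..<r})) \<subseteq> S \<union> T"
          using that(3) xB(2) by (subst pairs_insert) auto
        moreover have "x \<in> PiE {..<r} B"
          using that(2) xB(1) by (auto simp: PiE_iff)
        ultimately show ?thesis using vM unfolding has_transversal_def by blast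
      qed
      then show "of_bool (bad (S \<union> T)) \<le> (of_bool (\<forall>i<t. \<forall>x\<in>PiE {..<r} (D i). \<not> pairs (x ` {..<r}) \<subseteq> T) :: real)"
        unfolding bad_def by auto
    qed (use p in auto)
    also have "\<dots> \<le> ?R"
    proof (rule janson_transversal[OF r t(1) p fin(2) _ _ _ L])
      show "finite (D i j) \<and> card (D i j) = d" if "i < t" "j < r" for i j
        using vD that DB finB by (meson finite_subset)
      show "i = i' \<and> j = j'" if "i < t" "j < r" "i' < t" "j' < r" "D i j \<inter> D i' j' \<noteq> {}" for i j i' j'
      proof -
        have jj: "j = j'" using BB[of j j'] DB that by blast
        have "i = i'"
        proof (rule ccontr)
          assume "i \<noteq> i'"
          then consider "i < i'" | "i' < i" by linarith
          then show False using vD that jj by cases blast+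
        qed
        with jj show ?thesis by simp
      qed
      show "pairs (x ` {..<r}) \<subseteq> E2" if "i < t" "x \<in> PiE {..<r} (D i)" for i x
        unfolding E2_def using that DB by (intro pairs_mono) (fastforce simp: PiE_iff)
    qed
    finally show ?thesis .
  qed
  have "?P = bexp p E1 (\<lambda>S. bexp p E2 (\<lambda>T. of_bool (bad (S \<union> T))))"
    unfolding bad_def[symmetric] un(1) by (rule bexp_Un) (use fin un in auto)
  also have "\<dots> \<le> bexp p E1 (\<lambda>_. ?R)" using p inner by (intro bexp_mono) auto
  finally show ?thesis using fin by simp
qed

definition all_transversals :: "nat \<Rightarrow> nat \<Rightarrow> nat \<Rightarrow> 'a set \<Rightarrow> 'a set set \<Rightarrow> bool" where
  "all_transversals r m a W S \<longleftrightarrow> (\<forall>M B. M \<subseteq> W \<and> card M = m \<and>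
     (\<forall>j<r. B j \<subseteq> W \<and> card (B j) = a \<and> M \<inter> B j = {}) \<and> (\<forall>j j'. j < j' \<and> j' < r \<longrightarrow> B j \<inter> B j' = {})
     \<longrightarrow> has_transversal S r M B)"

text \<open>A failure has one of two witnesses: a pair of sets with all degrees below
  \<open>d\<close>, or a rich configuration without a transversal. The first kind is counted by
  binomial coefficients; for the second, the crude count of \<open>2 ^ card W\<close> choices for
  each of \<open>r + 1\<close> sets is affordable. Parts have size \<open>2 * b\<close> so that
  \<open>b\<close> vertices remain when stars have used up to \<open>b\<close>.\<close>

theorem bexp_all_transversals:
  fixes V :: "'a set"
  assumes r: "r \<ge> 2" and t: "t \<ge> 1" "t * d \<le> b" and p: "0 < p" "p \<le> 1"
    and V: "finite V" "W \<subseteq> V" and m: "r * m' < m" and d: "d \<ge> 1" "real d - 1 \<le> p * b / 4"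
    and L: "L > 0" "\<And>k. 2 \<le> k \<Longrightarrow> k \<le> r \<Longrightarrow> L \<le> real d ^ k * p ^ (k choose 2)"
  shows "bexp p (pairs V) (\<lambda>S. of_bool (\<not> all_transversals r m (2 * b) W S))
    \<le> real (card W choose m') * real (card W choose b) * exp (- (p * m' * b / 4)) +
      2 ^ (card W * (r + 1)) * exp (- (real t * L / 2 ^ (r + 1)))"
proof -
  have finW: "finite W" using V finite_subset by blast
  define Q1 where "Q1 = {(M, B). M \<subseteq> W \<and> card M = m' \<and> B \<subseteq> W \<and> card B = b \<and> M \<inter> B = {}}"
  define Q2 where "Q2 = {(M, B). M \<in> Pow W \<and> B \<in> PiE {..<r} (\<lambda>_. Pow W) \<and> card M = m \<and>
     (\<forall>j<r. card (B j) = 2 * b \<and> M \<inter> B j = {}) \<and> (\<forall>j j'. j < j' \<and> j' < r \<longrightarrow> B j \<inter> B j' = {})}"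
  let ?F1 = "\<lambda>(M, B) S. \<forall>v\<in>M. card (nbrs S v B) < d"
  let ?F2 = "\<lambda>(M, B) S. (\<forall>j<r. rich m' b d S M (B j)) \<and> \<not> has_transversal S r M B"
  have sub1: "Q1 \<subseteq> {M. M \<subseteq> W \<and> card M = m'} \<times> {B. B \<subseteq> W \<and> card B = b}" unfolding Q1_def by auto
  have sub2: "Q2 \<subseteq> Pow W \<times> PiE {..<r} (\<lambda>_. Pow W)" unfolding Q2_def by auto
  have fin1: "finite Q1" by (rule finite_subset[OF sub1]) (use finW in auto)
  have fin2: "finite Q2" by (rule finite_subset[OF sub2]) (use finW in \<open>auto intro!: finite_PiE\<close>)
  have "card Q1 \<le> card ({M. M \<subseteq> W \<and> card M = m'} \<times> {B. B \<subseteq> W \<and> card B = b})"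
    using sub1 finW by (intro card_mono) auto
  then have card1: "card Q1 \<le> (card W choose m') * (card W choose b)"
    using finW by (simp add: card_cartesian_product n_subsets)
  have "card Q2 \<le> card (Pow W \<times> PiE {..<r} (\<lambda>_. Pow W))"
    using sub2 finW by (intro card_mono finite_cartesian_product finite_PiE) auto
  also have "\<dots> = 2 ^ card W * (2 ^ card W) ^ r"
    using finW by (simp add: card_cartesian_product card_PiE card_Pow)
  also have "\<dots> = 2 ^ (card W * (r + 1))" by (simp add: power_mult power_add)
  finally have card2: "card Q2 \<le> 2 ^ (card W * (r + 1))" .
  have dich: "(\<exists>q\<in>Q1. ?F1 q S) \<or> (\<exists>q\<in>Q2. ?F2 q S)" if S: "\<not> all_transversals r m (2 * b) W S" for S
  proof -
    obtain M B0 where MB0: "M \<subseteq> W" "card M = m" "\<And>j. j < r \<Longrightarrow> B0 j \<subseteq> W \<and> card (B0 j) = 2 * b \<and> M \<inter> B0 j = {}"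
      "\<And>j j'. j < j' \<Longrightarrow> j' < r \<Longrightarrow> B0 j \<inter> B0 j' = {}" "\<not> has_transversal S r M B0"
    proof -
      define ok where "ok M B0 \<longleftrightarrow> M \<subseteq> W \<and> card M = m \<and>
        (\<forall>j<r. B0 j \<subseteq> W \<and> card (B0 j) = 2 * b \<and> M \<inter> B0 j = {}) \<and>
        (\<forall>j j'. j < j' \<and> j' < r \<longrightarrow> B0 j \<inter> B0 j' = {})" for M B0
      have "\<exists>M B0. ok M B0 \<and> \<not> has_transversal S r M B0"
        using S unfolding all_transversals_def ok_def[symmetric] by blast
      then obtain M B0 where "ok M B0" "\<not> has_transversal S r M B0" by blast
      then show thesis using that[of M B0] unfolding ok_def by simp
    qed
    \<comment> \<open>Restriction to \<open>{..<r}\<close> makes \<open>B\<close> extensional, hence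
      a member of the finite product that indexes \<open>Q2\<close>.\<close>
    define B where "B = restrict B0 {..<r}"
    have B: "B j = B0 j" if "j < r" for j using that unfolding B_def by simp
    have "PiE {..<r} B = PiE {..<r} B0" by (rule PiE_cong) (use B in auto)
    then have "has_transversal S r M B = has_transversal S r M B0"
      unfolding has_transversal_def by simp
    then have nt: "\<not> has_transversal S r M B" using MB0(5) by simp
    have inQ2: "(M, B) \<in> Q2"
      unfolding Q2_def using MB0 B by (auto simp: B_def)
    show ?thesis
    proof (cases "\<forall>j<r. rich m' b d S M (B j)")
      case True
      then show ?thesis using nt inQ2 by blast
    next
      case False
      then obtain j M' B' where j: "j < r" "M' \<subseteq> M" "B' \<subseteq> B j" "card M' = m'" "card B' = b"
        "\<not> (\<exists>v\<in>M'. d \<le> card (nbrs S v B'))" unfolding rich_def by blast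
      then have "(M', B') \<in> Q1" unfolding Q1_def using MB0(1) MB0(3)[OF j(1)] B[OF j(1)] by auto
      moreover have "?F1 (M', B') S" using j(6) by auto
      ultimately show ?thesis by blast
    qed
  qed
  have "bexp p (pairs V) (\<lambda>S. of_bool (\<not> all_transversals r m (2 * b) W S))
    \<le> bexp p (pairs V) (\<lambda>S. of_bool (\<exists>q\<in>Q1. ?F1 q S) + of_bool (\<exists>q\<in>Q2. ?F2 q S))"
  proof (rule bexp_mono)
    fix S
    show "of_bool (\<not> all_transversals r m (2 * b) W S)
      \<le> (of_bool (\<exists>q\<in>Q1. ?F1 q S) + of_bool (\<exists>q\<in>Q2. ?F2 q S) :: real)"
    proof -
      have "(\<not> X \<Longrightarrow> Y \<or> Z) \<Longrightarrow> of_bool (\<not> X) \<le> (of_bool Y + of_bool Z :: real)" for X Y Z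
        by (cases X; cases Y; cases Z) auto
      from this[OF dich] show ?thesis .
    qed
  qed (use p in auto)
  also have "\<dots> \<le> (\<Sum>q\<in>Q1. bexp p (pairs V) (\<lambda>S. of_bool (?F1 q S))) + (\<Sum>q\<in>Q2. bexp p (pairs V) (\<lambda>S. of_bool (?F2 q S)))"
    unfolding bexp_add using p by (intro add_mono bexp_union_bound fin1 fin2) auto
  also have "\<dots> \<le> (\<Sum>q\<in>Q1. exp (- (p * m' * b / 4))) + (\<Sum>q\<in>Q2. exp (- (real t * L / 2 ^ (r + 1))))"
  proof (intro add_mono sum_mono)
    fix q assume "q \<in> Q1"
    then obtain M B where q: "q = (M, B)" "M \<subseteq> W" "card M = m'" "B \<subseteq> W" "card B = b" "M \<inter> B = {}"
      unfolding Q1_def by auto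
    have "bexp p (pairs V) (\<lambda>S. of_bool (\<forall>v\<in>M. card (nbrs S v B) < d)) \<le> exp (- (p * card M * card B / 4))"
    proof (rule bexp_small_degrees)
      show "finite M" "finite B" using q finW finite_subset by blast+
      show "{v, w} \<in> pairs V" if "v \<in> M" "w \<in> B" for v w
        using that q V unfolding doubleton_in_pairs by blast
    qed (use V p d q in auto)
    then show "bexp p (pairs V) (\<lambda>S. of_bool (?F1 q S)) \<le> exp (- (p * m' * b / 4))"
      using q by simp
  next
    fix q assume "q \<in> Q2"
    then obtain M B where q: "q = (M, B)" "M \<subseteq> W" "B \<in> PiE {..<r} (\<lambda>_. Pow W)" "card M = m"
      "\<And>j. j < r \<Longrightarrow> card (B j) = 2 * b \<and> M \<inter> B j = {}" "\<And>j j'. j < j' \<Longrightarrow> j' < r \<Longrightarrow> B j \<inter> B j' = {}"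
      unfolding Q2_def by auto
    have "bexp p (pairs V) (\<lambda>S. of_bool ((\<forall>j<r. rich m' b d S M (B j)) \<and> \<not> has_transversal S r M B))
       \<le> exp (- (real t * L / 2 ^ (r + 1)))"
    proof (rule bexp_rich_no_transversal[OF r t p V(1) _ _ _ _ _ _ L])
      show "M \<subseteq> V" using q V by blast
      show "B j \<subseteq> V" if "j < r" for j using q(3) V that by (auto simp: PiE_iff)
    qed (use q m in auto)
    then show "bexp p (pairs V) (\<lambda>S. of_bool (?F2 q S)) \<le> exp (- (real t * L / 2 ^ (r + 1)))"
      using q(1) by simp
  qed
  also have "\<dots> = real (card Q1) * exp (- (p * m' * b / 4)) + real (card Q2) * exp (- (real t * L / 2 ^ (r + 1)))"
    by simp
  also have "\<dots> \<le> real ((card W choose m') * (card W choose b)) * exp (- (p * m' * b / 4)) +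
      real (2 ^ (card W * (r + 1))) * exp (- (real t * L / 2 ^ (r + 1)))"
    using card1 card2 by (intro add_mono mult_right_mono) (auto simp only: of_nat_le_iff exp_ge_zero)
  finally show ?thesis by simp
qed

section \<open>Graphs without long paths\<close>

definition is_path :: "('a \<Rightarrow> 'a \<Rightarrow> bool) \<Rightarrow> 'a set \<Rightarrow> 'a list \<Rightarrow> bool" where
  "is_path R U xs \<longleftrightarrow> distinct xs \<and> set xs \<subseteq> U \<and> successively R xs"

definition separated :: "('a \<Rightarrow> 'a \<Rightarrow> bool) \<Rightarrow> 'a set \<Rightarrow> 'a set \<Rightarrow> bool" where
  "separated R A B \<longleftrightarrow> A \<inter> B = {} \<and> (\<forall>x\<in>A. \<forall>y\<in>B. \<not> R x y)"

lemma separated_sym: "symp R \<Longrightarrow> separated R A B \<Longrightarrow> separated R B A"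
  unfolding separated_def by (metis Int_commute sympD)

lemma separated_mono: "separated R A B \<Longrightarrow> A' \<subseteq> A \<Longrightarrow> B' \<subseteq> B \<Longrightarrow> separated R A' B'"
  unfolding separated_def by blast

lemma is_path_length:
  assumes "finite U" "is_path R U xs"
  shows "length xs \<le> card U"
  using assms unfolding is_path_def by (metis card_mono distinct_card)

lemma is_path_mono: "is_path R U xs \<Longrightarrow> U \<subseteq> V \<Longrightarrow> is_path R V xs"
  unfolding is_path_def by blast

text \<open>This is depth-first search: \<open>D\<close> collects the vertices that have been dealt with, and
  \<open>xs\<close> is the current branch, which always starts at a root.\<close>

lemma dfs_partition:
  assumes fin: "finite V" and sym: "symp R" and Rt: "Rt \<subseteq> V"
    and root: "\<And>T. T \<subseteq> V \<Longrightarrow> T \<noteq> {} \<Longrightarrow> separated R T (V - T) \<Longrightarrow> T \<inter> Rt \<noteq> {}"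
    and t: "t \<le> card V"
  shows "\<exists>D xs. D \<subseteq> V \<and> card D = t \<and> is_path R V xs \<and> set xs \<inter> D = {} \<and>
     (xs \<noteq> [] \<longrightarrow> hd xs \<in> Rt) \<and> separated R D (V - D - set xs)"
  using t
proof (induction t)
  case 0
  show ?case
    by (rule exI[of _ "{}"], rule exI[of _ "[]"]) (auto simp: is_path_def separated_def)
next
  case (Suc t)
  define Q where "Q D xs \<longleftrightarrow> D \<subseteq> V \<and> card D = t \<and> is_path R V xs \<and> set xs \<inter> D = {} \<and>
     (xs \<noteq> [] \<longrightarrow> hd xs \<in> Rt) \<and> separated R D (V - D - set xs)" for D xs
  have "\<exists>D xs. Q D xs" unfolding Q_def using Suc.IH Suc.prems by simp
  then obtain D xs0 where Q0: "Q D xs0" by blast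
  have bdd: "\<forall>xs. Q D xs \<longrightarrow> length xs \<le> card V"
    using is_path_length[OF fin] unfolding Q_def by blast
  \<comment> \<open>For fixed \<open>D\<close>, a longest admissible branch takes the place of the
    forward steps of the search.\<close>
  obtain xs where Qxs: "Q D xs" and max: "\<And>ys. Q D ys \<Longrightarrow> length ys \<le> length xs"
    using ex_has_greatest_nat[of "Q D" xs0 length "Suc (card V)"] Q0 bdd by (auto simp: less_Suc_eq_le)
  have D: "D \<subseteq> V" "card D = t" "is_path R V xs" "set xs \<inter> D = {}" "xs \<noteq> [] \<Longrightarrow> hd xs \<in> Rt"
    "separated R D (V - D - set xs)" using Qxs unfolding Q_def by auto
  have finD: "finite D" using D(1) fin finite_subset by blast
  \<comment> \<open>With an empty branch, \<open>V - D\<close> would be closed under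
    \<open>R\<close>, so \<open>root\<close> would provide a vertex at which a longer branch
    starts.\<close>
  have "xs \<noteq> []"
  proof
    assume xs: "xs = []"
    have ne: "V - D \<noteq> {}" using Suc.prems D(1,2) finD
      by (metis Diff_eq_empty_iff Suc_n_not_le_n subset_antisym)
    have "separated R (V - D) (V - (V - D))"
      using separated_sym[OF sym D(6)] xs D(1) by (simp add: double_diff)
    then obtain u where u: "u \<in> V - D" "u \<in> Rt" using root[of "V - D"] ne by blast
    have "Q D [u]"
      unfolding Q_def using D u separated_mono[OF D(6)] xs by (auto simp: is_path_def)
    from max[OF this] xs show False by simp
  qed
  then obtain ys v where xs: "xs = ys @ [v]" by (metis append_butlast_last_id)
  have v: "v \<in> V" "v \<notin> D" using D xs unfolding is_path_def by auto
  \<comment> \<open>By maximality the last vertex \<open>v\<close> of the branch has no unexplored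
    neighbour, so it can be moved into \<open>D\<close>.\<close>
  have nov: "\<not> R v u" if u: "u \<in> V - D - set xs" for u
  proof
    assume "R v u"
    then have "is_path R V (xs @ [u])"
      using D(3) u xs unfolding is_path_def by (auto simp: successively_append_iff)
    moreover have "separated R D (V - D - set (xs @ [u]))"
      by (rule separated_mono[OF D(6)]) auto
    ultimately have "Q D (xs @ [u])"
      unfolding Q_def using D(1,2,4,5) u \<open>xs \<noteq> []\<close> by auto
    from max[OF this] show False by simp
  qed
  have "is_path R V ys" "set ys \<inter> insert v D = {}"
    using D(3,4) xs unfolding is_path_def by (auto simp: successively_append_iff)
  moreover have "ys \<noteq> [] \<longrightarrow> hd ys \<in> Rt" using D(5) xs by auto
  moreover have "separated R (insert v D) (V - insert v D - set ys)"
    using D(6) nov xs v unfolding separated_def by auto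
  moreover have "insert v D \<subseteq> V" "card (insert v D) = Suc t"
    using D v finD by auto
  ultimately show ?case by blast
qed

definition sep_family :: "('a \<Rightarrow> 'a \<Rightarrow> bool) \<Rightarrow> nat \<Rightarrow> 'a set \<Rightarrow> nat \<Rightarrow> 'a set set \<Rightarrow> bool" where
  "sep_family R a U k \<B> \<longleftrightarrow> finite \<B> \<and> card \<B> = k \<and> (\<forall>B\<in>\<B>. B \<subseteq> U \<and> a \<le> card B) \<and>
     pairwise (separated R) \<B>"

text \<open>A common member of both families would be separated from itself and hence empty, which
  \<open>a \<ge> 1\<close> excludes. So the cardinalities add.\<close>

lemma sep_family_Un:
  assumes "sep_family R a U k \<B>" "sep_family R a U' k' \<B>'" "separated R U U'" "symp R" "a \<ge> 1"
  shows "sep_family R a (U \<union> U') (k + k') (\<B> \<union> \<B>')"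
proof -
  have sepBB: "separated R B B'" if "B \<in> \<B>" "B' \<in> \<B>'" for B B'
    using assms(1,2) that unfolding sep_family_def
    by (intro separated_mono[OF assms(3)]) auto
  have "\<B> \<inter> \<B>' = {}"
  proof (rule ccontr)
    assume "\<B> \<inter> \<B>' \<noteq> {}"
    then obtain B where B: "B \<in> \<B>" "B \<in> \<B>'" by blast
    then have "B = {}" using sepBB[OF B] unfolding separated_def by blast
    then show False using B assms(1,5) unfolding sep_family_def by force
  qed
  then have "card (\<B> \<union> \<B>') = k + k'"
    using assms(1,2) unfolding sep_family_def by (auto simp: card_Un_disjoint)
  moreover have "pairwise (separated R) (\<B> \<union> \<B>')"
    unfolding pairwise_def
  proof (intro ballI impI)
    fix B B' assume "B \<in> \<B> \<union> \<B>'" "B' \<in> \<B> \<union> \<B>'" "B \<noteq> B'"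
    moreover have "pairwise (separated R) \<B>" "pairwise (separated R) \<B>'"
      using assms(1,2) unfolding sep_family_def by auto
    ultimately show "separated R B B'"
      using sepBB separated_sym[OF assms(4)] unfolding pairwise_def by (metis Un_iff)
  qed
  ultimately show ?thesis using assms(1,2) unfolding sep_family_def by auto
qed

lemma sep_family_mono: "sep_family R a U k \<B> \<Longrightarrow> U \<subseteq> V \<Longrightarrow> sep_family R a V k \<B>"
  unfolding sep_family_def by blast

text \<open>Each round of the search stops when \<open>a\<close> vertices are finished and discards
  a branch of at most \<open>n\<close> vertices. The last set takes no search, hence
  \<open>k - 1\<close> times \<open>n\<close>.\<close>

lemma sep_family_exists:
  assumes "finite V" "symp R" "a \<ge> 1" "\<And>xs. is_path R V xs \<Longrightarrow> length xs \<le> n"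
    and "k \<ge> 1" "(k - 1) * n + k * a \<le> card V"
  shows "\<exists>\<B>. sep_family R a V k \<B>"
  using assms(5,1,4,6)
proof (induction k arbitrary: V rule: dec_induct)
  case base
  then have "sep_family R a V 1 {V}" unfolding sep_family_def by auto
  then show ?case by blast
next
  case (step k)
  obtain D xs where D: "D \<subseteq> V" "card D = a" "is_path R V xs" "set xs \<inter> D = {}"
    "separated R D (V - D - set xs)"
    using dfs_partition[OF step.prems(1) assms(2) subset_refl, of a] step.prems(3) by auto
  define V' where "V' = V - D - set xs"
  have len: "card (set xs) \<le> n" using step.prems(2)[OF D(3)] card_length le_trans by blast
  have "card V \<le> card V' + card D + card (set xs)"
  proof -
    have "V \<subseteq> V' \<union> D \<union> set xs" unfolding V'_def by blast
    then have "card V \<le> card (V' \<union> D \<union> set xs)"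
      using step.prems(1) D(1) by (intro card_mono) (auto simp: V'_def intro: finite_subset)
    also have "\<dots> \<le> card V' + card D + card (set xs)"
      by (meson card_Un_le le_trans add_le_mono1)
    finally show ?thesis .
  qed
  moreover have "k * n = (k - 1) * n + n" using step.hyps by (cases k) auto
  ultimately have "(k - 1) * n + k * a \<le> card V'"
    using step.prems(3) D(2) len by simp
  then obtain \<B> where B: "sep_family R a V' k \<B>"
    using step.IH[of V'] step.prems(1,2) is_path_mono unfolding V'_def by blast
  have "sep_family R a D 1 {D}" using D unfolding sep_family_def by auto
  from sep_family_Un[OF this B _ assms(2,3)] D(5)
  have "sep_family R a (D \<union> V') (Suc k) ({D} \<union> \<B>)" by (simp add: V'_def)
  then show ?case using D(1) sep_family_mono[of _ _ "D \<union> V'"] unfolding V'_def by blast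
qed

section \<open>Posa rotations\<close>

definition steps :: "'a list \<Rightarrow> ('a \<times> 'a) set" where
  "steps xs = set (zip xs (tl xs))"

lemma steps_simps [simp]:
  "steps [] = {}" "steps [x] = {}" "steps (x # y # zs) = insert (x, y) (steps (y # zs))"
  by (auto simp: steps_def)

lemma steps_append: "steps (as @ u # bs) = steps (as @ [u]) \<union> steps (u # bs)"
  by (induction as rule: induct_list012) auto

lemma steps_Cons: "bs \<noteq> [] \<Longrightarrow> steps (u # bs) = insert (u, hd bs) (steps bs)"
  by (cases bs) auto

lemma steps_rev: "steps (rev xs) = (steps xs)\<inverse>"
proof (induction xs rule: induct_list012)
  case (3 x y zs)
  then show ?case
    using steps_append[of "rev zs" y "[x]"] by auto
qed auto

lemma steps_inj:
  assumes "distinct xs"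
  shows "(x, y) \<in> steps xs \<Longrightarrow> (x, y') \<in> steps xs \<Longrightarrow> y = y'"
    and "(x, y) \<in> steps xs \<Longrightarrow> (x', y) \<in> steps xs \<Longrightarrow> x = x'"
  using assms by (auto simp: steps_def in_set_zip nth_tl nth_eq_iff_index_eq)

lemma successively_rev_symp:
  assumes "symp R"
  shows "successively R (rev xs) \<longleftrightarrow> successively R xs"
  unfolding successively_rev using assms by (intro successively_cong) (auto dest: sympD)

text \<open>A rotation adds the edge from the last vertex to \<open>v\<close> and drops the step
  after \<open>v\<close>; the first vertex of the path stays fixed.\<close>

inductive_set rotations :: "('a \<Rightarrow> 'a \<Rightarrow> bool) \<Rightarrow> 'a list \<Rightarrow> 'a list set"
  for R xs where
    refl: "xs \<in> rotations R xs"
  | rotate: "as @ v # bs \<in> rotations R xs \<Longrightarrow> bs \<noteq> [] \<Longrightarrow> R (last bs) v \<Longrightarrow> as @ v # rev bs \<in> rotations R xs"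

lemma rotations_path:
  assumes "ys \<in> rotations R xs" "symp R" "is_path R U xs"
  shows "is_path R U ys \<and> set ys = set xs"
  using assms(1)
proof induction
  case (rotate as v bs)
  have "R v (last bs)" using rotate sympD[OF assms(2)] by blast
  show ?case using rotate \<open>R v (last bs)\<close>
    by (auto simp: is_path_def successively_append_iff successively_Cons hd_rev
        successively_rev_symp[OF assms(2)] simp del: successively_rev)
qed (use assms in auto)

text \<open>Posa's lemma.  A step of a rotated path that is not a step of the original path has been
  created together with an end vertex next to it.\<close>

lemma posa:
  assumes sym: "symp R" and P: "is_path R U xs" and ne: "xs \<noteq> []"
    and max: "\<And>ys. is_path R U ys \<Longrightarrow> length ys \<le> length xs"
    and S: "S = last ` rotations R xs"
  shows "S \<subseteq> set xs" and "S \<noteq> {}"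
    and "separated R S (U - set xs)"
    and "card {v\<in>U - S. \<exists>s\<in>S. R s v} \<le> 2 * card S"
proof -
  have dist: "distinct xs" using P unfolding is_path_def by blast
  have rot: "is_path R U ys" "set ys = set xs" "length ys = length xs" if "ys \<in> rotations R xs" for ys
    using rotations_path[OF that sym P] dist distinct_card unfolding is_path_def by metis+
  show 1: "S \<subseteq> set xs"
    using rot(2) ne unfolding S by (metis image_subsetI last_in_set set_empty)
  show "S \<noteq> {}" using rotations.refl unfolding S by blast
  have 3: "v \<in> set xs" if ys: "ys \<in> rotations R xs" and v: "v \<in> U" "R (last ys) v" for v ys
  proof (rule ccontr)
    assume "v \<notin> set xs"
    then have "is_path R U (ys @ [v])"
      using rot[OF ys] v unfolding is_path_def by (auto simp: successively_append_iff)
    from max[OF this] rot(3)[OF ys] show False by simp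
  qed
  then show "separated R S (U - set xs)"
    using 1 unfolding separated_def S by blast
  \<comment> \<open>Neighbours of \<open>S\<close> along the original path.\<close>
  define N where "N = {v. \<exists>w\<in>S. (v, w) \<in> steps xs \<or> (w, v) \<in> steps xs}"
  \<comment> \<open>A rotation at \<open>u\<close> replaces the step from \<open>u\<close> to
    \<open>hd bs\<close> by one from \<open>u\<close> to \<open>last bs\<close>, and both
    \<open>hd bs\<close> and \<open>last bs\<close> belong to \<open>S\<close>. A vertex outside
    \<open>S\<close> gains a step only as \<open>u\<close>; then it was next to \<open>hd bs\<close>
    before, and by induction this puts it into \<open>N\<close>.\<close>
  have new_steps: "(v, w) \<in> steps xs \<union> (steps xs)\<inverse>"
    if "ys \<in> rotations R xs" "v \<notin> S" "v \<notin> N" "(v, w) \<in> steps ys \<union> (steps ys)\<inverse>" for ys v w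
    using that
  proof (induction arbitrary: w)
    case (rotate as u bs)
    have "last (as @ u # rev bs) = hd bs" "last (as @ u # bs) = last bs"
      using rotate.hyps(2) by (simp_all add: last_rev)
    then have endS: "hd bs \<in> S" "last bs \<in> S"
      using rotations.rotate[OF rotate.hyps] rotate.hyps(1) unfolding S by (metis image_eqI)+
    have eq: "steps (as @ u # bs) = steps (as @ [u]) \<union> insert (u, hd bs) (steps bs)"
      "steps (as @ u # rev bs) = steps (as @ [u]) \<union> insert (u, last bs) ((steps bs)\<inverse>)"
      using rotate.hyps(2) by (simp_all add: steps_append[of as u bs] steps_append[of as u "rev bs"] steps_Cons steps_rev hd_rev)
    consider "(v, w) \<in> steps (as @ u # bs) \<union> (steps (as @ u # bs))\<inverse>" | "(v, w) = (u, last bs)" | "(v, w) = (last bs, u)"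
      using rotate.prems(3) unfolding eq by auto
    then show ?case
    proof cases
      case 1
      then show ?thesis using rotate.IH rotate.prems by blast
    next
      case 2
      have "(v, hd bs) \<in> steps xs \<union> (steps xs)\<inverse>"
        using 2 rotate.prems by (intro rotate.IH) (auto simp: eq)
      then have "v \<in> N" using endS unfolding N_def by blast
      then show ?thesis using rotate.prems by blast
    next
      case 3
      then show ?thesis using endS rotate.prems by auto
    qed
  qed simp
  \<comment> \<open>A neighbour \<open>v\<close> of an end lies on the rotated path, and rotating at
    \<open>v\<close> makes its successor an end. Either \<open>v\<close> is in \<open>N\<close>, or
    that step belongs to the original path, which again gives membership in
    \<open>N\<close>.\<close>
  have sub: "{v\<in>U - S. \<exists>s\<in>S. R s v} \<subseteq> N"
  proof
    fix v assume "v \<in> {v\<in>U - S. \<exists>s\<in>S. R s v}"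
    then obtain ys where v: "v \<in> U" "v \<notin> S" and ys: "ys \<in> rotations R xs" "R (last ys) v"
      unfolding S by blast
    have "v \<in> set ys" using 3[OF ys(1) v(1) ys(2)] rot(2)[OF ys(1)] by simp
    then obtain as bs where split: "ys = as @ v # bs" by (meson split_list)
    have bs: "bs \<noteq> []" using v(2) ys(1) split unfolding S by (metis image_eqI last_snoc)
    have "as @ v # rev bs \<in> rotations R xs"
      using ys bs split by (intro rotations.rotate) auto
    moreover have "last (as @ v # rev bs) = hd bs" using bs by (simp add: last_rev)
    ultimately have "hd bs \<in> S" unfolding S by (metis image_eqI)
    moreover have "(v, hd bs) \<in> steps ys" using split bs by (simp add: steps_append[of as v bs] steps_Cons)
    ultimately show "v \<in> N"
      using new_steps[OF ys(1) v(2), of "hd bs"] unfolding N_def by blast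
  qed
  have finS: "finite S" using 1 finite_subset by blast
  \<comment> \<open>Each vertex has at most one predecessor and one successor on \<open>xs\<close>;
    where there is none, the value of \<open>THE\<close> is arbitrary.\<close>
  define f where "f w = (THE v. (v, w) \<in> steps xs)" for w
  define g where "g w = (THE v. (w, v) \<in> steps xs)" for w
  have "N \<subseteq> f ` S \<union> g ` S"
  proof
    fix v assume "v \<in> N"
    then obtain w where w: "w \<in> S" "(v, w) \<in> steps xs \<or> (w, v) \<in> steps xs" unfolding N_def by blast
    have "v = f w" if "(v, w) \<in> steps xs"
      unfolding f_def using that steps_inj(2)[OF dist] by (metis the_equality)
    moreover have "v = g w" if "(w, v) \<in> steps xs"
      unfolding g_def using that steps_inj(1)[OF dist] by (metis the_equality)
    ultimately show "v \<in> f ` S \<union> g ` S" using w by blast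
  qed
  with sub have "card {v\<in>U - S. \<exists>s\<in>S. R s v} \<le> card (f ` S \<union> g ` S)"
    using finS by (intro card_mono) auto
  also have "\<dots> \<le> card (f ` S) + card (g ` S)" by (rule card_Un_le)
  also have "\<dots> \<le> 2 * card S" using card_image_le[OF finS, of f] card_image_le[OF finS, of g] by simp
  finally show "card {v\<in>U - S. \<exists>s\<in>S. R s v} \<le> 2 * card S" .
qed

section \<open>Components and the deterministic partition\<close>

lemma successively_closed:
  assumes "separated R C (W - C)" "is_path R W xs" "xs \<noteq> []" "hd xs \<in> C"
  shows "set xs \<subseteq> C"
  using assms(2-4)
proof (induction xs)
  case (Cons x xs)
  show ?case
  proof (cases xs)
    case (Cons y ys)
    have "R x y" "y \<in> W" "is_path R W xs"
      using Cons.prems Cons unfolding is_path_def by auto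
    then have "hd xs \<in> C" using assms(1) Cons.prems Cons unfolding separated_def by auto
    then show ?thesis using Cons.IH \<open>is_path R W xs\<close> Cons.prems Cons by auto
  qed (use Cons.prems in auto)
qed simp

text \<open>The components are the classes of the reflexive transitive closure of \<open>R\<close>
  inside \<open>W\<close>. Connectedness is expressed by the last clause in terms of closed sets,
  the form that suits the root condition of the search.\<close>

lemma components_exist:
  fixes R :: "'a \<Rightarrow> 'a \<Rightarrow> bool"
  assumes "symp R"
  obtains \<C> where "\<Union>\<C> = W" "{} \<notin> \<C>" "pairwise (separated R) \<C>"
    "\<And>C T. C \<in> \<C> \<Longrightarrow> separated R T (W - T) \<Longrightarrow> T \<inter> C \<noteq> {} \<Longrightarrow> C \<subseteq> T"
proof
  define \<rho> where "\<rho> = {(x, y). x \<in> W \<and> y \<in> W \<and> R x y}"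
  have sym: "sym (\<rho>\<^sup>*)"
    using assms by (intro sym_rtrancl) (auto simp: sym_def symp_def \<rho>_def)
  have inW: "y \<in> W" if "(x, y) \<in> \<rho>\<^sup>*" "x \<in> W" for x y
    using that by induction (auto simp: \<rho>_def)
  let ?C = "(\<lambda>x. \<rho>\<^sup>* `` {x}) ` W"
  show "\<Union>?C = W" using inW by auto
  show "{} \<notin> ?C" by auto
  show "pairwise (separated R) ?C"
    unfolding pairwise_def
  proof (intro ballI impI)
    fix A B assume "A \<in> ?C" "B \<in> ?C" and ne: "A \<noteq> B"
    then obtain x y where xy: "x \<in> W" "y \<in> W" "A = \<rho>\<^sup>* `` {x}" "B = \<rho>\<^sup>* `` {y}" by blast
    have no: "(x, y) \<notin> \<rho>\<^sup>*"
    proof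
      assume "(x, y) \<in> \<rho>\<^sup>*"
      then have "A = B" using xy sym by (auto intro: rtrancl_trans dest: symD)
      then show False using ne by simp
    qed
    have "(u, v) \<notin> \<rho>\<^sup>*" if "u \<in> A" "v \<in> B" for u v
    proof
      assume "(u, v) \<in> \<rho>\<^sup>*"
      moreover have "(x, u) \<in> \<rho>\<^sup>*" "(v, y) \<in> \<rho>\<^sup>*" using that xy symD[OF sym] by auto
      ultimately show False using no by (meson rtrancl_trans)
    qed
    then show "separated R A B"
    proof -
      have "A \<inter> B = {}" using \<open>\<And>u v. u \<in> A \<Longrightarrow> v \<in> B \<Longrightarrow> (u, v) \<notin> \<rho>\<^sup>*\<close> by blast
      moreover have "\<not> R u v" if "u \<in> A" "v \<in> B" for u v
        using \<open>\<And>u v. u \<in> A \<Longrightarrow> v \<in> B \<Longrightarrow> (u, v) \<notin> \<rho>\<^sup>*\<close>[OF that] that inW xy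
        unfolding \<rho>_def by blast
      ultimately show ?thesis unfolding separated_def by blast
    qed
  qed
  fix C T assume C: "C \<in> ?C" and T: "separated R T (W - T)" "T \<inter> C \<noteq> {}"
  then obtain x u where x: "C = \<rho>\<^sup>* `` {x}" "u \<in> T" "(x, u) \<in> \<rho>\<^sup>*" by blast
  have "v \<in> T" if "(u, v) \<in> \<rho>\<^sup>*" for v
    using that
  proof induction
    case (step y z)
    then show ?case using T(1) unfolding separated_def \<rho>_def by blast
  qed (use x in auto)
  moreover have "(u, v) \<in> \<rho>\<^sup>*" if "v \<in> C" for v
    using that x rtrancl_trans[OF symD[OF sym]] by blast
  ultimately show "C \<subseteq> T" by blast
qed

text \<open>The deterministic core, with \<open>nobad\<close> encoding the absence of a blue clique.
  The exceptional set is a union of two sets of fewer than \<open>m\<close> vertices each; the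
  resulting slack of 2 later absorbs the rounding in \<open>m\<close>.\<close>

theorem path_free_partition:
  fixes R :: "'a \<Rightarrow> 'a \<Rightarrow> bool"
  assumes fin: "finite W" and sym: "symp R" and r: "r \<ge> 1" and m: "1 \<le> m" "m \<le> a"
    and an: "12 * r * a \<le> n" and mn: "100 * m \<le> n"
    and size: "3 * r * n \<le> 3 * card W + n"
    and nopath: "\<And>xs. is_path R W xs \<Longrightarrow> length xs \<le> n"
    and nobad: "\<And>M \<B>. M \<subseteq> W \<Longrightarrow> m \<le> card M \<Longrightarrow> sep_family R a W r \<B> \<Longrightarrow>
       (\<And>B. B \<in> \<B> \<Longrightarrow> separated R M B) \<Longrightarrow> False"
  obtains A0 \<P> where "finite \<P>" "card \<P> = r" "A0 \<union> \<Union>\<P> = W" "A0 \<inter> \<Union>\<P> = {}"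
    "pairwise (separated R) \<P>" "\<And>P. P \<in> \<P> \<Longrightarrow> card P \<le> n" "card A0 + 2 \<le> 2 * m"
proof -
  define N where "N U Y = {v\<in>U - Y. \<exists>y\<in>Y. R y v}" for U Y
  have finN: "finite (N U Y)" if "U \<subseteq> W" for U Y
    using that fin finite_subset unfolding N_def by fastforce
  have rn: "r * n = (r - 1) * n + n" using r by (cases r) auto
  have a1: "a \<ge> 1" using m by simp
  have ra: "a \<le> r * a" using r by simp
  \<comment> \<open>Otherwise enough vertices remain outside \<open>Y\<close> and its neighbourhood
    for \<open>sep_family_exists\<close> to find \<open>r\<close> separated sets, which contradict
    \<open>nobad\<close> with \<open>M = Y\<close>.\<close>
  have large: "card W < card Y + card (N W Y) + (r - 1) * n + r * a" if Y: "Y \<subseteq> W" "m \<le> card Y" for Y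
  proof (rule ccontr)
    assume neg: "\<not> ?thesis"
    let ?V = "W - Y - N W Y"
    have "card W \<le> card (?V \<union> Y \<union> N W Y)"
      using fin Y(1) finN[of W Y] by (intro card_mono) (auto intro: finite_subset)
    also have "\<dots> \<le> card ?V + card Y + card (N W Y)"
      by (meson card_Un_le le_trans add_le_mono1)
    finally have "(r - 1) * n + r * a \<le> card ?V" using neg by simp
    moreover have "\<And>xs. is_path R ?V xs \<Longrightarrow> length xs \<le> n"
      by (rule nopath[OF is_path_mono]) auto
    ultimately obtain \<B> where B: "sep_family R a ?V r \<B>"
      using sep_family_exists[of ?V R a n r] fin sym a1 r by auto
    have "separated R Y ?V" unfolding separated_def N_def by blast
    moreover have "A \<subseteq> ?V" if "A \<in> \<B>" for A using B that unfolding sep_family_def by blast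
    ultimately have "separated R Y A" if "A \<in> \<B>" for A
      using separated_mono[of R Y ?V Y A] that by simp
    then show False using nobad[OF Y sep_family_mono[OF B]] by auto
  qed
  \<comment> \<open>The cap \<open>2 * m\<close> leaves room to add up to \<open>m\<close> vertices
    to a set of fewer than \<open>m\<close>, as \<open>expand\<close> requires.\<close>
  define Q where "Q X \<longleftrightarrow> X \<subseteq> W \<and> card X \<le> 2 * m \<and> card (N W X) \<le> 2 * card X" for X
  have "Q {}" by (simp add: Q_def N_def)
  moreover have "\<forall>X. Q X \<longrightarrow> card X < Suc (2 * m)" unfolding Q_def by auto
  ultimately obtain X where QX: "Q X" and Xmax: "\<And>Y. Q Y \<Longrightarrow> card Y \<le> card X"
    using ex_has_greatest_nat[of Q "{}" card "Suc (2 * m)"] by metis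
  have X: "X \<subseteq> W" "card X \<le> 2 * m" "card (N W X) \<le> 2 * card X" using QX unfolding Q_def by auto
  have finX: "finite X" using X(1) fin finite_subset by blast
  \<comment> \<open>Otherwise \<open>large\<close> would give
    \<open>card W < 6 * m + (r - 1) * n + r * a\<close>, too small for \<open>size\<close>.\<close>
  have Xm: "card X < m"
  proof (rule ccontr)
    assume "\<not> card X < m"
    then have "card W < card X + card (N W X) + (r - 1) * n + r * a" using large[OF X(1)] by simp
    then show False using X size rn an mn m by (simp add: algebra_simps)
  qed
  define W' where "W' = W - X"
  have W': "W' \<subseteq> W" "finite W'" using fin unfolding W'_def by auto
  have cardW': "card W' + card X = card W"
    using X(1) fin finX unfolding W'_def by (simp add: card_Diff_subset card_mono)
  \<comment> \<open>A set violating this could be added to \<open>X\<close>: the neighbourhood of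
    \<open>X \<union> Y\<close> is covered by that of \<open>X\<close> in \<open>W\<close> and that
    of \<open>Y\<close> in \<open>W'\<close>.\<close>
  have expand: "2 * card Y < card (N W' Y)" if Y: "Y \<subseteq> W'" "Y \<noteq> {}" "card Y \<le> m" for Y
  proof (rule ccontr)
    assume neg: "\<not> ?thesis"
    have finY: "finite Y" using Y W' finite_subset by blast
    have c: "card (X \<union> Y) = card X + card Y"
      using Y finX finY unfolding W'_def by (intro card_Un_disjoint) auto
    have "N W (X \<union> Y) \<subseteq> N W X \<union> N W' Y" unfolding N_def W'_def by blast
    then have "card (N W (X \<union> Y)) \<le> card (N W X \<union> N W' Y)"
      using finN W' by (intro card_mono) auto
    also have "\<dots> \<le> card (N W X) + card (N W' Y)" by (rule card_Un_le)
    also have "\<dots> \<le> 2 * card (X \<union> Y)" using neg X c by simp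
    finally have "Q (X \<union> Y)" using X Y W' c Xm unfolding Q_def by auto
    from Xmax[OF this] c have "card Y = 0" by simp
    then show False using finY Y by simp
  qed
  obtain \<C> where C: "\<Union>\<C> = W'" "{} \<notin> \<C>" "pairwise (separated R) \<C>"
    and Cmin: "\<And>C T. C \<in> \<C> \<Longrightarrow> separated R T (W' - T) \<Longrightarrow> T \<inter> C \<noteq> {} \<Longrightarrow> C \<subseteq> T"
    using components_exist[OF sym, of W'] by metis
  have finC: "finite \<C>" using C(1) W'(2) by (metis finite_UnionD)
  have Csub: "C \<subseteq> W'" if "C \<in> \<C>" for C using that C by blast
  have Cclosed: "separated R C (W' - C)" if "C \<in> \<C>" for C
    using that C unfolding separated_def pairwise_def by blast
  have "\<exists>xs. xs \<noteq> [] \<and> is_path R C xs \<and> (\<forall>ys. is_path R C ys \<longrightarrow> length ys \<le> length xs)"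
    if c: "C \<in> \<C>" for C
  proof -
    obtain x where x: "x \<in> C" using C(2) c by (metis ex_in_conv)
    have "is_path R C [x]" using x by (simp add: is_path_def)
    moreover have "\<forall>ys. is_path R C ys \<longrightarrow> length ys < Suc n"
      using nopath is_path_mono Csub[OF c] W' by (metis le_imp_less_Suc)
    ultimately obtain xs where "is_path R C xs" "\<forall>ys. is_path R C ys \<longrightarrow> length ys \<le> length xs"
      using ex_has_greatest_nat[of "is_path R C" "[x]" length "Suc n"] by blast
    moreover from this have "xs \<noteq> []" using \<open>is_path R C [x]\<close> by fastforce
    ultimately show ?thesis by blast
  qed
  then obtain P where P: "\<And>C. C \<in> \<C> \<Longrightarrow> P C \<noteq> []" "\<And>C. C \<in> \<C> \<Longrightarrow> is_path R C (P C)"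
    and Pmax: "\<And>C ys. C \<in> \<C> \<Longrightarrow> is_path R C ys \<Longrightarrow> length ys \<le> length (P C)"
    by metis
  define S where "S C = last ` rotations R (P C)" for C
  note posaC = posa[OF sym P(2) P(1) Pmax S_def]
  have Psub: "set (P C) \<subseteq> C" if "C \<in> \<C>" for C using P(2)[OF that] unfolding is_path_def by blast
  have Ssub: "S C \<subseteq> C" if "C \<in> \<C>" for C using posaC(1) Psub that by blast
  have Pn: "card (set (P C)) \<le> n" if "C \<in> \<C>" for C
    using nopath[OF is_path_mono[OF P(2)[OF that]]] Csub[OF that] W'
    by (meson card_length le_trans subset_trans)
  \<comment> \<open>Posa's bound and \<open>expand\<close> give more than \<open>m\<close> ends. Any
    \<open>m\<close> of them have at most \<open>m + 3 * card (S C)\<close> neighbours, and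
    \<open>large\<close> then forces \<open>card (S C)\<close> to be of order \<open>n\<close>,
    above \<open>a\<close>.\<close>
  have Sa: "a \<le> card (S C)" if c: "C \<in> \<C>" for C
  proof -
    have finS: "finite (S C)" using Ssub[OF c] Csub[OF c] W' by (meson finite_subset)
    have "N W' (S C) \<subseteq> {v\<in>C - S C. \<exists>s\<in>S C. R s v}"
      using Ssub[OF c] Cclosed[OF c] unfolding N_def separated_def by blast
    then have "card (N W' (S C)) \<le> card {v\<in>C - S C. \<exists>s\<in>S C. R s v}"
      using Csub[OF c] W' by (intro card_mono) (auto intro: finite_subset)
    also have "\<dots> \<le> 2 * card (S C)" using posaC(4) c by blast
    finally have NS: "card (N W' (S C)) \<le> 2 * card (S C)" .
    have sub: "S C \<subseteq> W'" using Ssub[OF c] Csub[OF c] by blast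
    have "m < card (S C)" using expand[OF sub] posaC(2) c NS by fastforce
    then obtain Y where Y: "Y \<subseteq> S C" "card Y = m"
      using obtain_subset_with_card_n[of m "S C"] by auto
    have "N W Y \<subseteq> X \<union> N W' (S C) \<union> S C" using Y(1) unfolding N_def W'_def by blast
    then have "card (N W Y) \<le> card (X \<union> N W' (S C) \<union> S C)"
      using finX finN[OF W'(1)] finS by (intro card_mono) auto
    also have "\<dots> \<le> card X + card (N W' (S C)) + card (S C)"
      by (meson card_Un_le le_trans add_le_mono1)
    finally have "card (N W Y) \<le> m + 3 * card (S C)" using NS Xm by simp
    moreover have "card W < card Y + card (N W Y) + (r - 1) * n + r * a"
      using large[of Y] Y sub W' by auto
    ultimately have "2 * n < 6 * m + 3 * (r * a) + 9 * card (S C)"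
      using Y(2) size rn by (simp add: algebra_simps)
    moreover have "12 * (r * a) \<le> n" using an by (simp add: mult.assoc)
    ultimately show ?thesis using mn ra by linarith
  qed
  have S_sep: "separated R (S C) (S C')" if "C \<in> \<C>" "C' \<in> \<C>" "C \<noteq> C'" for C C'
    using C(3) that unfolding pairwise_def by (intro separated_mono[OF _ Ssub Ssub]) auto
  have S_ne: "S C \<noteq> {}" if "C \<in> \<C>" for C using Sa[OF that] a1 by auto
  have injS: "inj_on S \<C>"
  proof (rule inj_onI, rule ccontr)
    fix C C' assume "C \<in> \<C>" "C' \<in> \<C>" "S C = S C'" "C \<noteq> C'"
    then show False using S_sep[of C C'] S_ne[of C] unfolding separated_def by auto
  qed
  have famS: "sep_family R a (\<Union>(S ` \<C>')) (card \<C>') (S ` \<C>')" if "\<C>' \<subseteq> \<C>" for \<C>'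
    unfolding sep_family_def
  proof (intro conjI ballI)
    show "finite (S ` \<C>')" using that finC finite_subset by blast
    show "card (S ` \<C>') = card \<C>'" using injS that card_image inj_on_subset by blast
    show "pairwise (separated R) (S ` \<C>')"
      unfolding pairwise_def using S_sep that by blast
  qed (use that Sa in auto)
  have US: "\<Union>(S ` \<C>') \<subseteq> W" if "\<C>' \<subseteq> \<C>" for \<C>' using that Ssub Csub W' by blast
  have famW: "sep_family R a W (card \<C>') (S ` \<C>')" if "\<C>' \<subseteq> \<C>" for \<C>'
    using sep_family_mono[OF famS[OF that] US[OF that]] .
  define U where "U = W' - (\<Union>C\<in>\<C>. set (P C))"
  have U: "U \<subseteq> W'" "finite U" "U \<subseteq> W" using W' unfolding U_def by auto
  \<comment> \<open>Within its component, an end of \<open>P C\<close> has neighbours only on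
    \<open>P C\<close>; in other components it has none.\<close>
  have sepU: "separated R U (S C)" if c: "C \<in> \<C>" for C
  proof -
    have "separated R (S C) (C - set (P C))" using posaC(3) c by blast
    then have "separated R (S C) U"
      using Ssub[OF c] Cclosed[OF c] c posaC(1)[OF c c c] unfolding U_def separated_def by blast
    then show ?thesis using separated_sym[OF sym] by blast
  qed
  define k where "k = card \<C>"
  \<comment> \<open>With more than \<open>r\<close> components, one set of ends serves as
    \<open>M\<close> and \<open>r\<close> others as the separated family.\<close>
  have kr: "k \<le> r"
  proof (rule ccontr)
    assume "\<not> k \<le> r"
    then obtain C0 where c0: "C0 \<in> \<C>" unfolding k_def by fastforce
    then have "r \<le> card (\<C> - {C0})" using \<open>\<not> k \<le> r\<close> finC unfolding k_def by simp
    then obtain \<C>' where C': "\<C>' \<subseteq> \<C> - {C0}" "card \<C>' = r"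
      by (metis obtain_subset_with_card_n)
    have f: "sep_family R a W r (S ` \<C>')"
      using famW[of \<C>'] C' by auto
    have "separated R (S C0) B" if "B \<in> S ` \<C>'" for B
      using that C' c0 S_sep by auto
    moreover have "S C0 \<subseteq> W" using Ssub[OF c0] Csub[OF c0] W' by blast
    moreover have "m \<le> card (S C0)" using Sa[OF c0] m by simp
    ultimately show False using nobad[OF _ _ f, of "S C0"] by blast
  qed
  have cardU: "card W' \<le> card U + k * n"
  proof -
    have "card W' \<le> card (U \<union> (\<Union>C\<in>\<C>. set (P C)))"
      using U finC by (intro card_mono) (auto simp: U_def)
    also have "\<dots> \<le> card U + card (\<Union>C\<in>\<C>. set (P C))" by (rule card_Un_le)
    also have "card (\<Union>C\<in>\<C>. set (P C)) \<le> (\<Sum>C\<in>\<C>. card (set (P C)))"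
      using finC by (rule card_UN_le)
    also have "\<dots> \<le> (\<Sum>C\<in>\<C>. n)" using Pn by (intro sum_mono) auto
    finally show ?thesis unfolding k_def by simp
  qed
  show ?thesis
  proof (cases "k = r")
    case True
    \<comment> \<open>Otherwise \<open>U\<close> would serve as \<open>M\<close> for the family of
      the \<open>r\<close> sets of ends.\<close>
    have Um: "card U < m"
    proof (rule ccontr)
      assume "\<not> card U < m"
      moreover have f: "sep_family R a W r (S ` \<C>)"
        using famW[of \<C>] True unfolding k_def by simp
      moreover have "separated R U B" if "B \<in> S ` \<C>" for B
        using that sepU by auto
      ultimately show False using nobad[OF U(3) _ f] by simp
    qed
    let ?P = "(\<lambda>C. set (P C)) ` \<C>"
    have P_sep: "separated R (set (P C)) (set (P C'))" if "C \<in> \<C>" "C' \<in> \<C>" "C \<noteq> C'" for C C'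
      using C(3) that unfolding pairwise_def by (intro separated_mono[OF _ Psub Psub]) auto
    show thesis
    proof
      show "finite ?P" using finC by simp
      have "inj_on (\<lambda>C. set (P C)) \<C>"
      proof (rule inj_onI, rule ccontr)
        fix C C' assume "C \<in> \<C>" "C' \<in> \<C>" "set (P C) = set (P C')" "C \<noteq> C'"
        then show False using P_sep[of C C'] P(1)[of C] unfolding separated_def by auto
      qed
      then show "card ?P = r" using True card_image unfolding k_def by metis
      have "\<Union>?P \<subseteq> W'" using Psub Csub by blast
      then show "X \<union> U \<union> \<Union>?P = W" "(X \<union> U) \<inter> \<Union>?P = {}"
        using X(1) unfolding U_def W'_def by auto
      show "pairwise (separated R) ?P" unfolding pairwise_def using P_sep by blast
      show "card A \<le> n" if "A \<in> ?P" for A using that Pn by blast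
      show "card (X \<union> U) + 2 \<le> 2 * m" using card_Un_le[of X U] Xm Um by simp
    qed
  next
    case False
    then have k: "k < r" using kr by simp
    \<comment> \<open>Roots are the vertices of \<open>U\<close> that can be attached to one of the
      chosen paths. Starting branches only there halves the bound on their length.\<close>
    define Rt where "Rt = {u\<in>U. \<exists>C\<in>\<C>. \<exists>y\<in>set (P C). R y u}"
    \<comment> \<open>A closed subset of \<open>U\<close> without roots would be closed in
      \<open>W'\<close>, hence contain a whole component and with it some \<open>P C\<close>, which
      is disjoint from \<open>U\<close>.\<close>
    have root: "T \<inter> Rt \<noteq> {}" if T: "T \<subseteq> U" "T \<noteq> {}" "separated R T (U - T)" for T
    proof
      assume no: "T \<inter> Rt = {}"
      have "\<not> R x y" if x: "x \<in> T" and y: "y \<in> W' - T" for x y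
      proof (cases "y \<in> U")
        case True
        then show ?thesis using T(3) x y unfolding separated_def by blast
      next
        case False
        then obtain C where "C \<in> \<C>" "y \<in> set (P C)" using y unfolding U_def by blast
        moreover have "x \<in> U" "x \<notin> Rt" using x T(1) no by auto
        ultimately show ?thesis using sympD[OF sym, of x y] unfolding Rt_def by blast
      qed
      then have "separated R T (W' - T)" unfolding separated_def by blast
      moreover obtain C where c: "C \<in> \<C>" "T \<inter> C \<noteq> {}" using T(1,2) U(1) C(1) by blast
      ultimately have "C \<subseteq> T" using Cmin by blast
      then have "set (P C) \<subseteq> U" using Psub[OF c(1)] T(1) by auto
      moreover have "set (P C) \<inter> U = {}" using c(1) unfolding U_def by auto
      ultimately show False using P(1)[OF c(1)] by (metis inf.absorb1 set_empty)
    qed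
    \<comment> \<open>The branch is attached at \<open>y\<close> to either part of
      \<open>P C\<close>. Neither result is longer than \<open>P C\<close>, and adding the two
      inequalities gives \<open>2 * length xs < length (P C)\<close>.\<close>
    have short: "2 * length xs \<le> n" if xs: "is_path R U xs" "xs \<noteq> []" "hd xs \<in> Rt" for xs
    proof (rule ccontr)
      assume neg: "\<not> ?thesis"
      obtain C y where c: "C \<in> \<C>" "y \<in> set (P C)" "R y (hd xs)" using xs(3) unfolding Rt_def by blast
      obtain as bs where split: "P C = as @ y # bs" using split_list[OF c(2)] by blast
      have "y \<in> C" using Psub[OF c(1)] c(2) by auto
      moreover have "hd xs \<in> W'" using xs(3) U(1) unfolding Rt_def by auto
      ultimately have "hd xs \<in> C" using c(3) Cclosed[OF c(1)] unfolding separated_def by auto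
      then have xsC: "set xs \<subseteq> C"
        using successively_closed[OF Cclosed[OF c(1)] is_path_mono[OF xs(1) U(1)] xs(2)] by blast
      have disj: "set xs \<inter> set (P C) = {}" using xs(1) c(1) unfolding is_path_def U_def by blast
      have "is_path R C (as @ [y] @ xs)" "is_path R C (rev bs @ [y] @ xs)"
        using P(2)[OF c(1)] xs xsC disj c(3) split sympD[OF sym]
        unfolding is_path_def by (auto simp: successively_append_iff successively_Cons last_rev
            successively_rev_symp[OF sym] simp del: successively_rev)
      from Pmax[OF c(1) this(1)] Pmax[OF c(1) this(2)]
      have "2 * length xs < length (P C)" using split by simp
      moreover have "length (P C) \<le> n"
        using nopath[OF is_path_mono[OF P(2)[OF c(1)]]] Csub[OF c(1)] W' by blast
      ultimately show False using neg by simp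
    qed
    obtain k' where k': "r = k + Suc k'" using k by (metis add_Suc_right less_imp_Suc_add)
    have mU: "m \<le> card U" using cardU cardW' Xm size mn unfolding k' by (simp add: algebra_simps)
    have RtU: "Rt \<subseteq> U" unfolding Rt_def by blast
    obtain D xs where D: "D \<subseteq> U" "card D = m"
      "is_path R U xs" "set xs \<inter> D = {}" "xs \<noteq> [] \<longrightarrow> hd xs \<in> Rt" "separated R D (U - D - set xs)"
      using dfs_partition[OF U(2) sym RtU root mU] by blast
    let ?V = "U - D - set xs"
    have len: "2 * card (set xs) \<le> n" using short[OF D(3)] D(5) card_length[of xs] by (cases xs) auto
    have "card U \<le> card (?V \<union> D \<union> set xs)"
      using U(2) D(1) by (intro card_mono) (auto intro: finite_subset)
    also have "\<dots> \<le> card ?V + card D + card (set xs)"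
      by (meson card_Un_le le_trans add_le_mono1)
    finally have "card U \<le> card ?V + m + card (set xs)" using D by simp
    \<comment> \<open>As the branch takes at most \<open>n / 2\<close> instead of \<open>n\<close>
      vertices, at least \<open>k' * n + n / 6 - 2 * m\<close> remain. This suffices because
      \<open>r * a \<le> n / 12\<close> and \<open>m \<le> n / 100\<close>.\<close>
    then have "k' * n + Suc k' * a \<le> card ?V"
      using len cardU cardW' Xm size mn an unfolding k' by (simp add: algebra_simps)
    moreover have "\<And>xs. is_path R ?V xs \<Longrightarrow> length xs \<le> n"
      by (rule nopath, erule is_path_mono) (use U in auto)
    ultimately obtain \<B> where B: "sep_family R a ?V (Suc k') \<B>"
      using sep_family_exists[of ?V R a n "Suc k'"] U sym a1 by auto
    have "separated R (S C) ?V" if "C \<in> \<C>" for C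
      by (rule separated_mono[OF separated_sym[OF sym sepU[OF that]]]) auto
    then have "separated R (\<Union>(S ` \<C>)) ?V" unfolding separated_def by auto
    from sep_family_Un[OF famS[OF subset_refl] B this sym a1]
    have f: "sep_family R a W r (S ` \<C> \<union> \<B>)"
      unfolding k' k_def by (rule sep_family_mono) (use US[of \<C>] U in auto)
    \<comment> \<open>The set \<open>D\<close> plays the role of \<open>M\<close>; the family
      consists of \<open>k\<close> sets of ends and \<open>Suc k'\<close> sets off the
      paths.\<close>
    have "separated R D A" if "A \<in> S ` \<C> \<union> \<B>" for A
    proof (cases "A \<in> \<B>")
      case True
      then have "A \<subseteq> ?V" using B unfolding sep_family_def by blast
      then show ?thesis using separated_mono[OF D(6) subset_refl] by simp
    next
      case False
      then obtain C where "C \<in> \<C>" "A = S C" using \<open>A \<in> S ` \<C> \<union> \<B>\<close> by blast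
      then show ?thesis using separated_mono[OF sepU[of C] D(1) subset_refl] by simp
    qed
    then have False using nobad[OF _ _ f, of D] D(1,2) U(3) by auto
    then show thesis ..
  qed
qed

section \<open>Colourings of the random graph\<close>

lemma red_path_copy:
  assumes "is_path (\<lambda>x y. {x, y} \<in> S \<and> c {x, y} = Red) W xs" "W \<subseteq> V" "n < length xs"
  shows "contains_copy (colour_subgraph (V, S) c Red) (path_graph n)"
  unfolding contains_copy_def
proof (intro exI conjI ballI)
  let ?f = "\<lambda>i. xs ! i"
  have xs: "distinct xs" "set xs \<subseteq> W" "successively (\<lambda>x y. {x, y} \<in> S \<and> c {x, y} = Red) xs"
    using assms(1) unfolding is_path_def by auto
  show "inj_on ?f (verts (path_graph n))"
    using xs(1) assms(3) by (auto simp: path_graph_def inj_on_def nth_eq_iff_index_eq)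
  show "?f ` verts (path_graph n) \<subseteq> verts (colour_subgraph (V, S) c Red)"
  proof
    fix y assume "y \<in> ?f ` verts (path_graph n)"
    then obtain i where "i \<le> n" "y = xs ! i" by (auto simp: path_graph_def)
    then have "y \<in> set xs" using assms(3) by auto
    then show "y \<in> verts (colour_subgraph (V, S) c Red)"
      using xs(2) assms(2) by (auto simp: colour_subgraph_def)
  qed
  fix e assume "e \<in> edges (path_graph n)"
  then obtain i where "i < n" "e = {i, Suc i}" by (auto simp: path_graph_def)
  then show "?f ` e \<in> edges (colour_subgraph (V, S) c Red)"
    using xs(3) assms(3) by (auto simp: colour_subgraph_def successively_conv_nth)
qed

lemma all_transversalsD:
  assumes "all_transversals r m a W S" "M \<subseteq> W" "card M = m"
    and "\<And>j. j < r \<Longrightarrow> B j \<subseteq> W \<and> card (B j) = a \<and> M \<inter> B j = {}"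
    and "\<And>j j'. j < j' \<Longrightarrow> j' < r \<Longrightarrow> B j \<inter> B j' = {}"
  shows "has_transversal S r M B"
  by (rule assms(1)[unfolded all_transversals_def, THEN spec, THEN spec, THEN mp])
    (use assms(2-) in simp)

text \<open>Shrinking the sets to exact sizes makes \<open>all_transversals\<close> applicable. The
  transversal clique has its vertices in distinct sets with no red edges between them, so all its
  edges are blue.\<close>

lemma blue_clique_copy:
  fixes c :: "'a set \<Rightarrow> colour"
  assumes tr: "all_transversals r m a W S" and WV: "W \<subseteq> V"
    and M: "M \<subseteq> W" "m \<le> card M"
    and \<B>: "sep_family R a W r \<B>" "\<And>B. B \<in> \<B> \<Longrightarrow> separated R M B"
    and R: "R = (\<lambda>x y. {x, y} \<in> S \<and> c {x, y} = Red)"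
  shows "contains_copy (colour_subgraph (V, S) c Blue) (complete_simple_graph (r + 1))"
proof -
  have fin: "finite \<B>" and card: "card \<B> = r" and subB: "\<And>B. B \<in> \<B> \<Longrightarrow> B \<subseteq> W \<and> a \<le> card B"
    and pw: "pairwise (separated R) \<B>"
    using \<B>(1) unfolding sep_family_def by auto
  obtain g where g: "bij_betw g {..<r} \<B>"
    using ex_bij_betw_nat_finite[OF fin] card by (auto simp: atLeast0LessThan)
  have gB: "g j \<in> \<B>" if "j < r" for j using g that by (auto simp: bij_betw_def)
  have gsep: "separated R (g j) (g j')" if "j < r" "j' < r" "j \<noteq> j'" for j j'
  proof -
    have "g j \<noteq> g j'" using g that by (auto simp: bij_betw_def inj_on_def)
    then show ?thesis using pw gB that unfolding pairwise_def by simp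
  qed
  obtain M0 where M0: "M0 \<subseteq> M" "card M0 = m" using obtain_subset_with_card_n[OF M(2)] by blast
  have "\<exists>X. X \<subseteq> g j \<and> card X = a" if "j < r" for j
    using subB[OF gB[OF that]] by (metis obtain_subset_with_card_n)
  then obtain B where B: "\<And>j. j < r \<Longrightarrow> B j \<subseteq> g j \<and> card (B j) = a" by metis
  have "has_transversal S r M0 B"
  proof (rule all_transversalsD[OF tr _ M0(2)])
    show "M0 \<subseteq> W" using M0 M by blast
    show "B j \<subseteq> W \<and> card (B j) = a \<and> M0 \<inter> B j = {}" if j: "j < r" for j
      using B[OF j] subB[OF gB[OF j]] M0 \<B>(2)[OF gB[OF j]] unfolding separated_def by blast
    show "B j \<inter> B j' = {}" if "j < j'" "j' < r" for j j'
      using gsep[of j j'] B[of j] B[of j'] that unfolding separated_def by fastforce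
  qed
  then obtain v x where v: "v \<in> M0" and x: "x \<in> PiE {..<r} B"
    and clique: "pairs (insert v (x ` {..<r})) \<subseteq> S"
    unfolding has_transversal_def by blast
  \<comment> \<open>Index 0 stands for \<open>M\<close> and index \<open>j + 1\<close> for the part
    \<open>g j\<close>, so that all \<open>r + 1\<close> sets are treated alike.\<close>
  define f where "f i = (case i of 0 \<Rightarrow> v | Suc j \<Rightarrow> x j)" for i
  define h where "h i = (case i of 0 \<Rightarrow> M | Suc j \<Rightarrow> g j)" for i
  have fh: "f i \<in> h i" if "i < r + 1" for i
  proof (cases i)
    case (Suc j)
    then show ?thesis using that PiE_mem[OF x, of j] B[of j] by (auto simp: f_def h_def)
  qed (use v M0 in \<open>auto simp: f_def h_def\<close>)
  have hsep: "separated R (h i) (h k)" if "i < k" "k < r + 1" for i k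
    using that gsep gB \<B>(2) by (cases i; cases k) (auto simp: h_def)
  have hW: "h i \<subseteq> W" if "i < r + 1" for i
    using that subB gB M by (cases i) (auto simp: h_def)
  have blue: "{f i, f k} \<in> S \<and> c {f i, f k} = Blue \<and> f i \<noteq> f k" if ik: "i < k" "k < r + 1" for i k
  proof -
    have sep: "separated R (h i) (h k)" "f i \<in> h i" "f k \<in> h k" using hsep fh ik by auto
    then have ne: "f i \<noteq> f k" unfolding separated_def by (metis IntI empty_iff)
    have "f l \<in> insert v (x ` {..<r})" if "l < r + 1" for l
      using that by (cases l) (auto simp: f_def)
    then have "{f i, f k} \<in> pairs (insert v (x ` {..<r}))"
      using ik ne by (simp only: doubleton_in_pairs) simp
    then have "{f i, f k} \<in> S" using clique by blast
    moreover from this have "c {f i, f k} \<noteq> Red" using sep unfolding separated_def R by blast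
    ultimately show ?thesis using ne by (cases "c {f i, f k}") auto
  qed
  have inj: "inj_on f {..<r + 1}"
    by (rule linorder_inj_onI) (use blue in auto)
  show ?thesis
    unfolding contains_copy_def
  proof (intro exI conjI ballI)
    show "inj_on f (verts (complete_simple_graph (r + 1)))"
      using inj by (simp add: complete_simple_graph_def)
    show "f ` verts (complete_simple_graph (r + 1)) \<subseteq> verts (colour_subgraph (V, S) c Blue)"
      using fh hW WV by (fastforce simp: complete_simple_graph_def colour_subgraph_def)
    fix e assume "e \<in> edges (complete_simple_graph (r + 1))"
    then obtain i k where "e = {i, k}" "i < k" "k < r + 1"
      unfolding complete_simple_graph_def pairs_def card_2_iff
      by (auto simp: neq_iff insert_commute)
    then show "f ` e \<in> edges (colour_subgraph (V, S) c Blue)"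
      using blue[of i k] by (simp add: colour_subgraph_def)
  qed
qed

definition ramsey_or_partition :: "nat \<Rightarrow> nat \<Rightarrow> real \<Rightarrow> nat graph \<Rightarrow> bool" where
  "ramsey_or_partition r n K G \<longleftrightarrow> (\<forall>c :: nat set \<Rightarrow> colour.
         contains_copy (colour_subgraph G c Blue) (complete_simple_graph (r + 1)) \<or>
         contains_copy (colour_subgraph G c Red) (path_graph n) \<or>
         (\<exists>A. indexed_partition (verts G) r A \<and>
              real (card (A 0)) \<le> K \<and>
              (\<forall>i\<in>{1..r}. card (A i) \<le> n) \<and>
              (\<forall>i j. 1 \<le> i \<and> i < j \<and> j \<le> r \<longrightarrow>
                 (\<forall>x\<in>A i. \<forall>y\<in>A j. {x, y} \<in> edges G \<longrightarrow> c {x, y} = Blue))))"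

text \<open>If the graph is large, the partition of \<open>(r + 1) * n\<close> of its vertices would be too small to
  cover them.\<close>

lemma ramsey_or_partition_if_transversals:
  assumes r: "r \<ge> 1" and m: "1 \<le> m" "m \<le> a" and an: "12 * r * a \<le> n" and mn: "100 * m \<le> n"
    and N: "3 * r * n \<le> 3 * N + n" and K: "2 * real m - 2 \<le> K"
    and tr: "all_transversals r m a {..<min N ((r + 1) * n)} S"
  shows "ramsey_or_partition r n K ({..<N}, S)"
  unfolding ramsey_or_partition_def
proof (intro allI)
  fix c :: "nat set \<Rightarrow> colour"
  let ?G = "({..<N}, S)"
  \<comment> \<open>Cutting off at \<open>(r + 1) * n\<close> vertices keeps the union bound under
    control when \<open>N\<close> is much larger than \<open>n\<close>.\<close>
  define w where "w = min N ((r + 1) * n)"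
  define W where "W = {..<w}"
  define R where "R = (\<lambda>x y. {x, y} \<in> S \<and> c {x, y} = Red)"
  show "contains_copy (colour_subgraph ?G c Blue) (complete_simple_graph (r + 1)) \<or>
         contains_copy (colour_subgraph ?G c Red) (path_graph n) \<or>
         (\<exists>A. indexed_partition (verts ?G) r A \<and> real (card (A 0)) \<le> K \<and>
              (\<forall>i\<in>{1..r}. card (A i) \<le> n) \<and>
              (\<forall>i j. 1 \<le> i \<and> i < j \<and> j \<le> r \<longrightarrow>
                 (\<forall>x\<in>A i. \<forall>y\<in>A j. {x, y} \<in> edges ?G \<longrightarrow> c {x, y} = Blue)))"
  proof (cases "contains_copy (colour_subgraph ?G c Blue) (complete_simple_graph (r + 1)) \<or>
         contains_copy (colour_subgraph ?G c Red) (path_graph n)")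
    case False
    have WN: "W \<subseteq> {..<N}" unfolding W_def w_def by auto
    have sym: "symp R" unfolding R_def symp_def by (simp add: insert_commute)
    have size: "3 * r * n \<le> 3 * card W + n"
      using N unfolding W_def w_def by (simp add: min_def algebra_simps)
    have nopath: "length xs \<le> n" if "is_path R W xs" for xs
      using red_path_copy[OF that[unfolded R_def] WN] False by (meson not_less)
    have nobad: False if "M \<subseteq> W" "m \<le> card M" "sep_family R a W r \<B>" "\<And>B. B \<in> \<B> \<Longrightarrow> separated R M B" for M \<B>
      using blue_clique_copy[OF tr[folded w_def, folded W_def] WN that R_def] False by blast
    have "\<exists>A0 \<P>. finite \<P> \<and> card \<P> = r \<and> A0 \<union> \<Union>\<P> = W \<and> A0 \<inter> \<Union>\<P> = {} \<and>
      pairwise (separated R) \<P> \<and> (\<forall>P\<in>\<P>. card P \<le> n) \<and> card A0 + 2 \<le> 2 * m"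
    proof (rule path_free_partition[OF _ sym r m an mn size])
      show "finite W" by (simp add: W_def)
      show "\<And>xs. is_path R W xs \<Longrightarrow> length xs \<le> n" by (fact nopath)
      show "\<And>M \<B>. M \<subseteq> W \<Longrightarrow> m \<le> card M \<Longrightarrow> sep_family R a W r \<B> \<Longrightarrow>
        (\<And>B. B \<in> \<B> \<Longrightarrow> separated R M B) \<Longrightarrow> False" by (fact nobad)
    qed blast
    then obtain A0 \<P> where P: "finite \<P>" "card \<P> = r" "A0 \<union> \<Union>\<P> = W" "A0 \<inter> \<Union>\<P> = {}"
      "pairwise (separated R) \<P>" "\<And>P. P \<in> \<P> \<Longrightarrow> card P \<le> n" "card A0 + 2 \<le> 2 * m"
      by (elim exE conjE) blast
    have "card W \<le> card A0 + card (\<Union>\<P>)" using card_Un_le[of A0 "\<Union>\<P>"] P(3) by simp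
    also have "card (\<Union>\<P>) \<le> (\<Sum>P\<in>\<P>. card P)" by (rule card_Union_le_sum_card)
    also have "\<dots> \<le> r * n" using sum_bounded_above[of \<P> card n] P(2,6) by simp
    \<comment> \<open>The parts and \<open>A0\<close> cover fewer than \<open>(r + 1) * n\<close>
      vertices, so nothing was cut off.\<close>
    finally have "card W < (r + 1) * n" using P(7) mn m by (simp add: algebra_simps)
    then have "w = N" unfolding W_def w_def by (auto simp: min_def split: if_splits)
    then have WN': "W = {..<N}" unfolding W_def by simp
    obtain g where g: "bij_betw g {1..r} \<P>"
      using finite_same_card_bij[of "{1..r}" \<P>] P(1,2) by auto
    have gP: "g i \<in> \<P>" if "i \<in> {1..r}" for i using g that by (auto simp: bij_betw_def)
    have gsep: "separated R (g i) (g j)" if "i \<in> {1..r}" "j \<in> {1..r}" "i \<noteq> j" for i j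
    proof -
      have "g i \<noteq> g j" using inj_on_eq_iff[OF bij_betw_imp_inj_on[OF g] that(1,2)] that(3) by simp
      then show ?thesis using pairwiseD[OF P(5) gP[OF that(1)] gP[OF that(2)]] by simp
    qed
    define A where "A i = (if i = 0 then A0 else g i)" for i
    have img: "g ` {1..r} = \<P>" using g by (simp add: bij_betw_def)
    have "{0..r} = insert 0 {1..r}" by auto
    then have "(\<Union>i\<in>{0..r}. A i) = A 0 \<union> (\<Union>i\<in>{1..r}. A i)" by (simp only: UN_insert)
    also have "(\<Union>i\<in>{1..r}. A i) = \<Union>\<P>" unfolding img[symmetric] by (auto simp: A_def)
    finally have un: "(\<Union>i\<in>{0..r}. A i) = {..<N}" using P(3) WN' by (simp add: A_def)
    have disj: "disjoint_family_on A {0..r}"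
      unfolding disjoint_family_on_def
    proof (intro ballI impI)
      fix i j assume ij: "i \<in> {0..r}" "j \<in> {0..r}" "i \<noteq> j"
      have A0g: "A0 \<inter> g k = {}" if "k \<in> {1..r}" for k using gP[OF that] P(4) by blast
      consider "i = 0" "j \<in> {1..r}" | "j = 0" "i \<in> {1..r}" | "i \<in> {1..r}" "j \<in> {1..r}"
        using ij by fastforce
      then show "A i \<inter> A j = {}"
      proof cases
        case 3
        then show ?thesis using gsep[of i j] ij unfolding separated_def A_def by auto
      qed (use A0g in \<open>auto simp: A_def\<close>)
    qed
    have "c {x, y} = Blue" if "1 \<le> i" "i < j" "j \<le> r" "x \<in> A i" "y \<in> A j" "{x, y} \<in> S" for i j x y
    proof -
      have "\<not> R x y" using gsep[of i j] that unfolding separated_def A_def by auto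
      then show ?thesis using that unfolding R_def by (cases "c {x, y}") auto
    qed
    moreover have "\<forall>i\<in>{1..r}. card (A i) \<le> n" using gP P(6) by (auto simp: A_def)
    moreover have "real (card (A 0)) \<le> K" using P(7) K by (simp add: A_def)
    ultimately show ?thesis using un disj unfolding indexed_partition_def by (intro disjI2 exI[of _ A]) auto
  qed auto
qed

section \<open>Probability estimates and choice of parameters\<close>

lemma erdos_renyi_prob_ge:
  assumes p: "0 \<le> p" "p \<le> 1"
    and H: "\<And>S. good S \<Longrightarrow> P ({..<N}, S)"
    and bd: "bexp p (pairs {..<N}) (\<lambda>S. of_bool (\<not> good S)) \<le> \<epsilon>"
  shows "1 - \<epsilon> \<le> measure_pmf.prob (erdos_renyi N p) {G. P G}"
proof -
  let ?E = "pairs {..<N}"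
  have "erdos_renyi N p = map_pmf (Pair {..<N}) (map_pmf (\<lambda>b. {e \<in> ?E. b e}) (Pi_pmf ?E False (\<lambda>_. bernoulli_pmf p)))"
    unfolding erdos_renyi_def by (simp add: map_pmf_comp)
  then have "measure_pmf.prob (erdos_renyi N p) {G. P G} =
     measure_pmf.prob (map_pmf (\<lambda>b. {e \<in> ?E. b e}) (Pi_pmf ?E False (\<lambda>_. bernoulli_pmf p))) {S. P ({..<N}, S)}"
    by (simp add: vimage_def)
  also have "\<dots> = bexp p ?E (\<lambda>S. of_bool (P ({..<N}, S)))"
    by (rule prob_Pi_bernoulli) (use p in auto)
  finally have eq: "measure_pmf.prob (erdos_renyi N p) {G. P G} = bexp p ?E (\<lambda>S. of_bool (P ({..<N}, S)))" .
  have "1 - bexp p ?E (\<lambda>S. of_bool (\<not> good S)) = bexp p ?E (\<lambda>S. 1 - of_bool (\<not> good S))"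
    by (simp add: bexp_diff)
  also have "\<dots> \<le> bexp p ?E (\<lambda>S. of_bool (P ({..<N}, S)))"
    using H by (intro bexp_mono p) auto
  finally show ?thesis using bd eq by simp
qed

text \<open>One term of the binomial expansion of \<open>(1 + y) ^ w\<close>. The free parameter
  \<open>y\<close> takes the place of \<open>b / w\<close> in the usual estimate.\<close>

lemma binomial_le_exp:
  fixes y :: real
  assumes y: "y > 0"
  shows "real (w choose b) \<le> exp (w * y) / y ^ b"
proof (cases "b \<le> w")
  case True
  have "real (w choose b) * y ^ b \<le> (\<Sum>k\<le>w. real (w choose k) * y ^ k)"
    using True y by (intro member_le_sum) auto
  also have "\<dots> = (1 + y) ^ w" using binomial_ring[of y 1 w] by (simp add: add.commute)
  also have "\<dots> \<le> exp y ^ w" using y exp_ge_add_one_self[of y] by (intro power_mono) auto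
  also have "\<dots> = exp (w * y)" by (simp add: exp_of_nat_mult)
  finally show ?thesis using y by (simp add: field_simps)
qed (use y in \<open>simp add: binomial_eq_0\<close>)

lemma binomial_le_power: "real (w choose k) \<le> real w ^ k"
proof (cases "k \<le> w")
  case True
  then show ?thesis using binomial_le_pow[OF True] by (simp flip: of_nat_power)
qed (simp add: binomial_eq_0)

lemma real_choose_two: "real (k choose 2) = real k * (real k - 1) / 2"
proof -
  have "even (k * (k - 1))" by (cases k) auto
  then have "real (k * (k - 1) div 2) = real (k * (k - 1)) / 2" by (simp add: real_of_nat_div)
  then show ?thesis by (cases k) (auto simp: choose_two algebra_simps)
qed

text \<open>The bottleneck is \<open>k = r\<close>, which is where the threshold \<open>n powr (- 2 / (r + 2))\<close> comes from.\<close>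

lemma clique_count_lower:
  fixes p x \<omega> \<kappa> :: real
  assumes k: "2 \<le> k" "k \<le> r" and p: "0 < p" "p \<le> 1" and x: "x \<ge> 1" and \<omega>: "\<omega> \<ge> 1"
    and \<kappa>: "0 < \<kappa>" "\<kappa> \<le> 1" and px: "\<omega> * x powr (- 2 / (real r + 2)) \<le> p"
    and d: "\<kappa> * x * p \<le> d"
  shows "\<kappa> ^ r * \<omega> * x * p \<le> d ^ k * p ^ (k choose 2)"
proof -
  \<comment> \<open>Since \<open>k - 1 + (k choose 2) = (k - 1) * (k + 2) / 2\<close>, the quantity
    to be bounded is essentially \<open>(x * y) ^ (k - 1)\<close>. As \<open>p \<le> 1\<close>,
    replacing \<open>k\<close> by \<open>r\<close> can only decrease \<open>y\<close>, which reduces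
    everything to the case \<open>k = r\<close>.\<close>
  define y where "y = p powr ((real k + 2) / 2)"
  have "x * y \<ge> \<omega>"
  proof -
    have "\<omega> = \<omega> powr 1" using \<omega> by simp
    also have "\<dots> \<le> \<omega> powr ((real r + 2) / 2)" using \<omega> by (intro powr_mono) auto
    also have "\<dots> = x * (\<omega> * x powr (- 2 / (real r + 2))) powr ((real r + 2) / 2)"
    proof -
      have "- 2 / (real r + 2) * ((real r + 2) / 2) = - 1" by (simp add: field_simps)
      then have "(x powr (- 2 / (real r + 2))) powr ((real r + 2) / 2) = x powr (- 1)"
        by (simp only: powr_powr)
      also have "\<dots> = 1 / x" using x by (simp add: powr_minus_divide)
      finally have e: "(x powr (- 2 / (real r + 2))) powr ((real r + 2) / 2) = 1 / x" .
      have "(\<omega> * x powr (- 2 / (real r + 2))) powr ((real r + 2) / 2) = \<omega> powr ((real r + 2) / 2) * (1 / x)"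
        unfolding e[symmetric] by (rule powr_mult)
      then show ?thesis using x by simp
    qed
    also have "\<dots> \<le> x * p powr ((real r + 2) / 2)"
      using x \<omega> px by (intro mult_left_mono powr_mono2) auto
    also have "\<dots> \<le> x * y" unfolding y_def using x p k by (intro mult_left_mono powr_mono') auto
    finally show ?thesis .
  qed
  have y: "p ^ (k - 1 + (k choose 2)) = y ^ (k - 1)"
  proof -
    have e1: "real (k - 1 + (k choose 2)) = (real k + 2) / 2 * real (k - 1)"
      using k by (simp add: real_choose_two of_nat_diff field_simps)
    then have "p powr real (k - 1 + (k choose 2)) = y powr real (k - 1)"
      unfolding y_def powr_powr by (simp only: e1)
    moreover have "y > 0" using p by (simp add: y_def)
    ultimately show ?thesis using p by (simp only: powr_realpow)
  qed
  have "\<omega> = \<omega> ^ 1" by simp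
  also have "\<dots> \<le> \<omega> ^ (k - 1)" using \<omega> k by (intro power_increasing) auto
  also have "\<dots> \<le> (x * y) ^ (k - 1)" using \<open>x * y \<ge> \<omega>\<close> \<omega> by (intro power_mono) auto
  finally have \<omega>k: "\<omega> \<le> x ^ (k - 1) * p ^ (k - 1 + (k choose 2))" by (simp only: power_mult_distrib y)
  have "\<kappa> ^ r \<le> \<kappa> ^ k" using \<kappa> k by (intro power_decreasing) auto
  then have "\<kappa> ^ r * \<omega> * x * p \<le> \<kappa> ^ k * (x ^ (k - 1) * p ^ (k - 1 + (k choose 2))) * x * p"
    using \<omega>k \<kappa> \<omega> x p by (intro mult_right_mono mult_mono) auto
  also have "\<dots> = \<kappa> ^ k * (x ^ Suc (k - 1)) * (p ^ Suc (k - 1) * p ^ (k choose 2))"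
    by (simp add: power_add mult_ac)
  also have "\<dots> = (\<kappa> * x * p) ^ k * p ^ (k choose 2)"
    using k by (simp add: power_mult_distrib)
  also have "\<dots> \<le> d ^ k * p ^ (k choose 2)"
    using d \<kappa> x p by (intro mult_right_mono power_mono) auto
  finally show ?thesis .
qed

text \<open>A finite form of the theorem: \<open>large1\<close> to \<open>large4\<close> say how
  large \<open>n\<close> and \<omega> must be. The two error terms come from the degrees and from
  Janson's inequality.\<close>

lemma ramsey_or_partition_prob:
  fixes p \<omega> C :: real
  assumes r: "r \<ge> 2" and C: "C = 2 ^ 8 * real r ^ 2" and N: "3 * r * n \<le> 3 * N + n"
    and p: "0 \<le> p" "p \<le> 1" and n: "48 * r \<le> n" and \<omega>: "\<omega> \<ge> 1"
    and px: "\<omega> * real n powr (- 2 / (real r + 2)) \<le> p"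
    and large1: "192 * real r \<le> sqrt n"
    and large2: "100 * (128 * real r ^ 2 * sqrt n + 1) \<le> n"
    and large3: "24 * real r * (128 * real r ^ 2 * sqrt n + 1) \<le> n"
    and large4: "((1 / (192 * real r)) ^ r * \<omega>) / 2 ^ (r + 1) \<ge> (real r + 1) ^ 2 + 1"
  shows "1 - (exp (33 * real r * sqrt n * ln ((real r + 1) * n) - n / 48) + exp (- real n))
    \<le> measure_pmf.prob (erdos_renyi N p) {G. ramsey_or_partition r n (C / p) G}"
proof -
  have n1: "real n \<ge> 1" "n \<ge> 1" using n r by auto
  \<comment> \<open>Since \<open>r \<ge> 2\<close>, the threshold is at least
    \<open>n powr (- (1 / 2))\<close>. So \<open>1 / p \<le> sqrt n\<close>, and quantities of order
    \<open>1 / p\<close> are negligible against \<open>n\<close>.\<close>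
  have "real n powr (- (1 / 2)) \<le> real n powr (- 2 / (real r + 2))"
    using n1 r by (intro powr_mono) (auto simp: field_simps)
  also have "\<dots> \<le> \<omega> * real n powr (- 2 / (real r + 2))"
    using mult_right_mono[OF \<omega>, of "real n powr (- 2 / (real r + 2))"] by simp
  finally have "real n powr (- (1 / 2)) \<le> p" using px by simp
  then have psqrt: "1 / sqrt n \<le> p" by (simp add: powr_minus_divide powr_half_sqrt)
  have sq: "sqrt n > 0" using n1 by simp
  have p0: "p > 0" using psqrt sq by (meson divide_pos_pos less_le_trans zero_less_one)
  have ip: "1 / p \<le> sqrt n" using psqrt sq p0 by (simp add: field_simps)
  have ip1: "1 \<le> 1 / p" using p p0 by simp
  have np: "sqrt n \<le> p * n"
  proof -
    have "sqrt n = 1 / sqrt n * n" using sq by (simp add: real_div_sqrt)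
    also have "\<dots> \<le> p * n" using psqrt by (intro mult_right_mono) auto
    finally show ?thesis .
  qed
  \<comment> \<open>Parts have \<open>2 * b\<close> vertices, about \<open>n / (12 * r)\<close>, and
    \<open>m\<close> is half of \<open>C / p\<close>, rounded up. Degrees must reach a quarter of
    their mean \<open>b * p\<close>, and \<open>t\<close> stars of this size fit into
    \<open>b\<close> vertices. The size of \<open>m'\<close> makes the exponent
    \<open>p * m' * b / 4\<close> at least \<open>8 * r * b\<close>, while
    \<open>r * m' < m\<close>.\<close>
  define b where "b = n div (24 * r)"
  define m where "m = nat \<lceil>128 * real r ^ 2 / p\<rceil>"
  define m' where "m' = nat \<lceil>32 * real r / p\<rceil>"
  define d where "d = nat \<lceil>b * p / 4\<rceil>"
  define t where "t = nat \<lceil>1 / p\<rceil>"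
  define L where "L = (1 / (192 * real r)) ^ r * \<omega> * n * p"
  define w where "w = min N ((r + 1) * n)"
  have b_up: "24 * r * b \<le> n" unfolding b_def by simp
  have "n < 24 * r + 24 * r * b"
    unfolding b_def by (rule dividend_less_times_div) (use r in simp)
  then have "n \<le> 48 * r * b" using n by linarith
  then have b_low: "real n \<le> 48 * real r * real b" by (metis of_nat_le_iff of_nat_mult of_nat_numeral)
  have r0: "real r > 0" "real r \<ge> 2" using r by auto
  have m_low: "128 * real r ^ 2 / p \<le> m" unfolding m_def by linarith
  have ceil_up: "real (nat \<lceil>z\<rceil>) \<le> z + 1" if "z \<ge> 0" for z :: real using that by linarith
  have m_up: "real m \<le> 128 * real r ^ 2 / p + 1" unfolding m_def using p0 by (intro ceil_up) auto
  have m_up2: "128 * real r ^ 2 / p + 1 \<le> 128 * real r ^ 2 * sqrt n + 1"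
    using mult_left_mono[OF ip, of "128 * real r ^ 2"] by simp
  have m'_low: "32 * real r / p \<le> m'" unfolding m'_def by linarith
  have m'_up: "real m' \<le> 32 * real r / p + 1" unfolding m'_def using p0 by (intro ceil_up) auto
  have bp: "4 \<le> b * p"
  proof -
    have "48 * real r * 4 \<le> p * n" using large1 np by simp
    also have "\<dots> \<le> p * (48 * real r * real b)" using b_low p0 by (intro mult_left_mono) auto
    finally have "48 * real r * 4 \<le> 48 * real r * (b * p)" by (simp add: mult_ac)
    then show ?thesis using r0 by (subst (asm) mult_le_cancel_left_pos) auto
  qed
  have d_low: "b * p / 4 \<le> d" unfolding d_def by linarith
  have d_up: "real d \<le> b * p / 4 + 1" unfolding d_def using bp by (intro ceil_up) auto
  have d1: "d \<ge> 1" using d_low bp by linarith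
  have t_low: "1 / p \<le> t" unfolding t_def by linarith
  have t_up: "real t \<le> 1 / p + 1" unfolding t_def using p0 by (intro ceil_up) auto
  have t1: "t \<ge> 1" using t_low ip1 by linarith
  have td: "t * d \<le> b"
  proof -
    have "real t \<le> 2 * (1 / p)" using t_up ip1 by linarith
    moreover have "real d \<le> b * p / 2" using d_up bp by linarith
    ultimately have "real t * real d \<le> (2 * (1 / p)) * (b * p / 2)"
      using p0 by (intro mult_mono) auto
    also have "\<dots> = b" using p0 by simp
    finally have "real (t * d) \<le> real b" by simp
    then show ?thesis by (simp only: of_nat_le_iff)
  qed
  have rm: "r * m' < m"
  proof -
    have 1: "real r * real m' \<le> real r * (32 * real r / p + 1)" using m'_up by (intro mult_left_mono) auto
    have 2: "real r * (32 * real r / p + 1) = 32 * (real r ^ 2 / p) + real r"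
      by (simp add: algebra_simps power2_eq_square)
    have "real r * 1 < real r * (96 * real r)" using r0 by (intro mult_strict_left_mono) auto
    moreover have "96 * real r ^ 2 * 1 \<le> 96 * real r ^ 2 * (1 / p)" using ip1 by (intro mult_left_mono) auto
    ultimately have 3: "real r < 96 * (real r ^ 2 / p)" by (simp add: power2_eq_square)
    have "128 * (real r ^ 2 / p) \<le> m" using m_low by simp
    then have "real r * real m' < real m" using 1 2 3 by linarith
    then have "real (r * m') < real m" by simp
    then show ?thesis by (simp only: of_nat_less_iff)
  qed
  have Lpos: "L > 0" unfolding L_def using r0 \<omega> n1 p0 by simp
  \<comment> \<open>Here \<kappa> is \<open>1 / (192 * r)\<close>, where 192 is 48 from
    \<open>b_low\<close> times 4 from the definition of \<open>d\<close>.\<close>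
  have Lk: "L \<le> real d ^ k * p ^ (k choose 2)" if "2 \<le> k" "k \<le> r" for k
    unfolding L_def
  proof (rule clique_count_lower[OF that p0 p(2) n1(1) \<omega> _ _ px])
    have "1 / (192 * real r) * n * p \<le> 1 / (192 * real r) * (48 * real r * b) * p"
      using b_low p0 r0 by (intro mult_right_mono mult_left_mono) auto
    also have "\<dots> = b * p / 4" using r0 by simp
    also note d_low
    finally show "1 / (192 * real r) * n * p \<le> d" .
  qed (use r0 in auto)
  let ?E = "pairs {..<N}"
  have W: "finite {..<N}" "{..<w} \<subseteq> {..<N}" unfolding w_def by auto
  have "bexp p ?E (\<lambda>S. of_bool (\<not> all_transversals r m (2 * b) {..<w} S))
    \<le> real (w choose m') * real (w choose b) * exp (- (p * m' * b / 4)) +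
      2 ^ (w * (r + 1)) * exp (- (real t * L / 2 ^ (r + 1)))"
    using bexp_all_transversals[OF r t1 td p0 p(2) W rm d1 _ Lpos Lk] d_up by (simp add: mult.commute)
  also have "\<dots> \<le> exp (33 * real r * sqrt n * ln ((real r + 1) * n) - n / 48) + exp (- real n)"
  proof (rule add_mono)
    have wn: "real w \<le> (real r + 1) * n" 
    proof -
      have "real w \<le> real ((r + 1) * n)" unfolding w_def by (simp only: of_nat_le_iff min.cobounded2)
      then show ?thesis by (simp add: algebra_simps)
    qed
    have "1 * 1 \<le> (real r + 1) * n" using n1 r0 by (intro mult_mono) auto
    then have big: "(real r + 1) * n \<ge> 1" by simp
    have lnb: "ln ((real r + 1) * n) \<ge> 0" using big by simp
    have c1: "real (w choose m') \<le> exp (33 * real r * sqrt n * ln ((real r + 1) * n))"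
    proof -
      have "real (w choose m') \<le> real w ^ m'" by (rule binomial_le_power)
      also have "\<dots> \<le> ((real r + 1) * n) ^ m'" using wn by (intro power_mono) auto
      also have "\<dots> = exp (m' * ln ((real r + 1) * n))" using big by (simp add: exp_of_nat_mult)
      also have "\<dots> \<le> exp (33 * real r * sqrt n * ln ((real r + 1) * n))"
      proof -
        have "32 * real r / p + 1 \<le> 33 * real r * (1 / p)"
        proof -
          have "1 * 1 \<le> real r * (1 / p)" using r0 ip1 by (intro mult_mono) auto
          then show ?thesis by simp
        qed
        also have "\<dots> \<le> 33 * real r * sqrt n" using ip r0 by (intro mult_left_mono) auto
        finally have "real m' \<le> 33 * real r * sqrt n" using m'_up by simp
        then show ?thesis using lnb by (simp add: mult_right_mono)
      qed
      finally show ?thesis .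
    qed
    have c2: "real (w choose b) \<le> exp (7 * real r * b)"
    proof -
      \<comment> \<open>With \<open>w \<le> (r + 1) * n\<close> and \<open>b_low\<close> this choice
        gives \<open>w * y \<le> b\<close>, while \<open>1 / y \<le> exp (6 * r)\<close>; together
        they yield the exponent \<open>7 * r * b\<close>.\<close>
      define y where "y = 1 / (48 * real r * (real r + 1))"
      have y0: "y > 0" unfolding y_def using r0 by simp
      have "w * y \<le> (real r + 1) * (48 * real r * real b) * y"
        using wn b_low y0 r0 by (intro mult_right_mono order_trans[OF wn] mult_left_mono) auto
      also have "\<dots> = b"
      proof -
        have z: "48 * real r * (real r + 1) \<noteq> 0" using r0 by simp
        have "(real r + 1) * (48 * real r * real b) * y = real b * (48 * real r * (real r + 1)) / (48 * real r * (real r + 1))"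
          unfolding y_def by simp
        then show ?thesis by (simp only: nonzero_mult_div_cancel_right[OF z])
      qed
      finally have wy: "w * y \<le> b" .
      have "48 * (real r * (real r + 1)) \<le> exp (4 * real r) * (exp (real r) * exp (real r))"
      proof (intro mult_mono)
        have "(48::real) \<le> 2 ^ 8" by simp
        also have "\<dots> \<le> exp 1 ^ 8" using exp_ge_add_one_self[of "1::real"] by (intro power_mono) auto
        also have "\<dots> = exp 8" by (simp flip: exp_of_nat_mult)
        also have "\<dots> \<le> exp (4 * real r)" using r0 by simp
        finally show "48 \<le> exp (4 * real r)" .
        show "real r \<le> exp (real r)" "real r + 1 \<le> exp (real r)"
          using exp_ge_add_one_self[of "real r"] by linarith+
      qed auto
      also have "\<dots> = exp (6 * real r)" by (simp flip: exp_add)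
      finally have iy: "1 / y \<le> exp (6 * real r)" by (simp add: y_def mult.assoc)
      have "real (w choose b) \<le> exp (w * y) / y ^ b" by (rule binomial_le_exp[OF y0])
      also have "\<dots> = exp (w * y) * (1 / y) ^ b" by (simp add: power_one_over)
      also have "\<dots> \<le> exp b * exp (6 * real r) ^ b"
        using wy iy y0 by (intro mult_mono power_mono) auto
      also have "\<dots> = exp (b + b * (6 * real r))" by (simp only: exp_add exp_of_nat_mult)
      also have "\<dots> \<le> exp (7 * real r * b)"
        using mult_right_mono[of 1 "real r" "real b"] r0 by (simp add: algebra_simps)
      finally show ?thesis .
    qed
    have "32 * real r \<le> p * m'" using m'_low p0 by (simp add: field_simps)
    then have c3: "8 * real r * b \<le> p * m' * b / 4"
      using mult_right_mono[of "32 * real r" "p * m'" "real b"] by simp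
    have "real (w choose m') * real (w choose b) * exp (- (p * m' * b / 4))
      \<le> exp (33 * real r * sqrt n * ln ((real r + 1) * n)) * exp (7 * real r * b) * exp (- (8 * real r * b))"
      using c1 c2 c3 by (intro mult_mono) auto
    \<comment> \<open>The exponents \<open>7 * r * b\<close> and \<open>- 8 * r * b\<close> leave
      \<open>- r * b\<close>, which is at most \<open>- n / 48\<close>.\<close>
    also have "\<dots> \<le> exp (33 * real r * sqrt n * ln ((real r + 1) * n) - n / 48)"
      using b_low by (simp flip: exp_add add: algebra_simps)
    finally show "real (w choose m') * real (w choose b) * exp (- (p * m' * b / 4))
      \<le> exp (33 * real r * sqrt n * ln ((real r + 1) * n) - n / 48)" .
    \<comment> \<open>As \<open>t\<close> is at least \<open>1 / p\<close>, the factor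
      \<open>p\<close> in \<open>L\<close> cancels and the exponent is linear in \<open>n\<close>.
      By \<open>large4\<close> its constant beats the \<open>(r + 1)\<^sup>2 * n\<close> from
      counting the sets.\<close>
    have "((real r + 1) ^ 2 + 1) * n \<le> ((1 / (192 * real r)) ^ r * \<omega>) / 2 ^ (r + 1) * n"
      using large4 by (intro mult_right_mono) auto
    also have "\<dots> = (1 / p) * L / 2 ^ (r + 1)" unfolding L_def using p0 by simp
    also have "\<dots> \<le> t * L / 2 ^ (r + 1)" using t_low Lpos by (intro divide_right_mono mult_right_mono) auto
    finally have tL: "((real r + 1) ^ 2 + 1) * n \<le> t * L / 2 ^ (r + 1)" .
    have "(2::real) ^ (w * (r + 1)) \<le> exp 1 ^ (w * (r + 1))"
      using exp_ge_add_one_self[of "1::real"] by (intro power_mono) auto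
    also have "\<dots> = exp (real w * (real r + 1))" by (simp flip: exp_of_nat_mult add: algebra_simps)
    also have "\<dots> \<le> exp (((real r + 1) * n) * (real r + 1))"
      using wn by (simp add: mult_right_mono)
    finally have "(2::real) ^ (w * (r + 1)) * exp (- (real t * L / 2 ^ (r + 1)))
      \<le> exp (((real r + 1) * n) * (real r + 1)) * exp (- (((real r + 1) ^ 2 + 1) * n))"
      using tL by (intro mult_mono) auto
    also have "\<dots> = exp (- real n)" by (simp flip: exp_add add: power2_eq_square algebra_simps)
    finally show "2 ^ (w * (r + 1)) * exp (- (real t * L / 2 ^ (r + 1))) \<le> exp (- real n)" .
  qed
  finally have bd: "bexp p ?E (\<lambda>S. of_bool (\<not> all_transversals r m (2 * b) {..<w} S))
    \<le> exp (33 * real r * sqrt n * ln ((real r + 1) * n) - n / 48) + exp (- real n)" .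
  show ?thesis
  proof (rule erdos_renyi_prob_ge[OF p _ bd])
    fix S assume S: "all_transversals r m (2 * b) {..<w} S"
    show "ramsey_or_partition r n (C / p) ({..<N}, S)"
    proof (rule ramsey_or_partition_if_transversals[OF _ _ _ _ _ N _ S[unfolded w_def]])
      show "r \<ge> 1" "1 \<le> m" using r rm by auto
      have "24 * real r * m \<le> 24 * real r * (128 * real r ^ 2 * sqrt n + 1)"
        using m_up m_up2 by (intro mult_left_mono) auto
      then have "24 * real r * m \<le> 24 * real r * (2 * real b)" using large3 b_low by linarith
      then have "real m \<le> 2 * real b" using r0 by (subst (asm) mult_le_cancel_left_pos) auto
      then show "m \<le> 2 * b" by linarith
      show "12 * r * (2 * b) \<le> n" using b_up by simp
      have "100 * real m \<le> 100 * (128 * real r ^ 2 * sqrt n + 1)"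
        using m_up m_up2 by (intro mult_left_mono) auto
      then have "100 * real m \<le> n" using large2 by (rule order_trans)
      then show "100 * m \<le> n" by linarith
      \<comment> \<open>Rounding \<open>m\<close> up costs at most 1, so \<open>2 * m - 2\<close> is
        at most \<open>2 * 128 * r ^ 2 / p = C / p\<close>.\<close>
      show "2 * real m - 2 \<le> C / p" using m_up unfolding C by simp
    qed
  qed
qed

theorem theorem4p1:
  fixes r :: nat and C :: real and N :: "nat \<Rightarrow> nat" and p :: "nat \<Rightarrow> real"
  assumes "r \<ge> 2"
    and "C = 2 ^ 8 * real r ^ 2"
    and "\<And>n. real (N n) \<ge> real r * real n - real n / 3"
    and "\<And>n. 0 \<le> p n \<and> p n \<le> 1"
    and "filterlim (\<lambda>n. p n / real n powr (- 2 / (real r + 2))) at_top sequentially"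
  shows "(\<lambda>n. measure_pmf.prob (erdos_renyi (N n) (p n))
      {G. \<forall>c :: nat set \<Rightarrow> colour.
         contains_copy (colour_subgraph G c Blue) (complete_simple_graph (r + 1)) \<or>
         contains_copy (colour_subgraph G c Red) (path_graph n) \<or>
         (\<exists>A. indexed_partition (verts G) r A \<and>
              real (card (A 0)) \<le> C / p n \<and>
              (\<forall>i\<in>{1..r}. card (A i) \<le> n) \<and>
              (\<forall>i j. 1 \<le> i \<and> i < j \<and> j \<le> r \<longrightarrow>
                 (\<forall>x\<in>A i. \<forall>y\<in>A j. {x, y} \<in> edges G \<longrightarrow> c {x, y} = Blue)))})
    \<longlonglongrightarrow> 1"
  unfolding ramsey_or_partition_def[symmetric]
proof (rule tendsto_sandwich[where h = "\<lambda>_. 1"])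
  have r: "real r > 0" using assms(1) by simp
  \<comment> \<open>A constant independent of \<open>n\<close> that meets \<open>large4\<close>;
    \<open>p\<close> exceeds the threshold by this factor for all large \<open>n\<close>.\<close>
  define \<omega> where "\<omega> = max 1 (2 ^ (r + 1) * ((real r + 1) ^ 2 + 1) / (1 / (192 * real r)) ^ r)"
  have \<omega>: "\<omega> \<ge> 1" "((1 / (192 * real r)) ^ r * \<omega>) / 2 ^ (r + 1) \<ge> (real r + 1) ^ 2 + 1"
  proof -
    show "\<omega> \<ge> 1" by (simp add: \<omega>_def)
    have "2 ^ (r + 1) * ((real r + 1) ^ 2 + 1) / (1 / (192 * real r)) ^ r \<le> \<omega>" by (simp add: \<omega>_def)
    then show "((1 / (192 * real r)) ^ r * \<omega>) / 2 ^ (r + 1) \<ge> (real r + 1) ^ 2 + 1"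
      using r by (simp add: field_simps)
  qed
  \<comment> \<open>In particular \<open>p n > 0\<close> eventually, so the default value
    \<open>C / 0 = 0\<close> concerns finitely many \<open>n\<close> only.\<close>
  have ev: "\<forall>\<^sub>F n in sequentially. \<omega> \<le> p n / real n powr (- 2 / (real r + 2))"
    using assms(5) unfolding filterlim_at_top by blast
  have l1: "\<forall>\<^sub>F n in sequentially. 192 * real r \<le> sqrt (real n)" using r by real_asymp
  have l2: "\<forall>\<^sub>F n in sequentially. 100 * (128 * real r ^ 2 * sqrt (real n) + 1) \<le> real n" using r by real_asymp
  have l3: "\<forall>\<^sub>F n in sequentially. 24 * real r * (128 * real r ^ 2 * sqrt (real n) + 1) \<le> real n" using r by real_asymp
  show "\<forall>\<^sub>F n in sequentially. 1 - (exp (33 * real r * sqrt n * ln ((real r + 1) * n) - n / 48) + exp (- real n))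
    \<le> measure_pmf.prob (erdos_renyi (N n) (p n)) {G. ramsey_or_partition r n (C / p n) G}"
    using ev l1 l2 l3 eventually_ge_at_top[of "48 * r"]
  proof eventually_elim
    case (elim n)
    have "n > 0" using elim(5) assms(1) by linarith
    then have "\<omega> * real n powr (- 2 / (real r + 2)) \<le> p n" using elim(1) by (simp add: field_simps)
    moreover have "3 * r * n \<le> 3 * N n + n"
    proof -
      have "3 * real r * real n \<le> 3 * real (N n) + real n" using assms(3)[of n] by simp
      then have "real (3 * r * n) \<le> real (3 * N n + n)" by simp
      then show ?thesis by (simp only: of_nat_le_iff)
    qed
    ultimately show ?case
      using assms(4)[of n] elim \<omega> by (intro ramsey_or_partition_prob[OF assms(1,2), where \<omega> = \<omega>]) auto
  qed
  show "(\<lambda>n. 1 - (exp (33 * real r * sqrt (real n) * ln ((real r + 1) * real n) - real n / 48) + exp (- real n))) \<longlonglongrightarrow> 1"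
    using r by real_asymp
qed (auto intro!: always_eventually)

end
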